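(* Let $(S_n)_{n\ge0}$ be the Dynamic Elephant Random Walk with $p\le 3/4$ or $\ell_{\sup}(\alpha)<\frac{1}{4p-2}$, where $\ell_{\inf}(\alpha)=\liminf_{n\to\infty}g(\alpha,n)$ and $\ell_{\sup}(\alpha)=\limsup_{n\to\infty}g(\alpha,n)$. Let $x\in\mathcal{X}$ and suppose that $p\cdot\ell_{\sup}(\alpha)<1$ and that both of the following implications hold: (D$_1$) if $p=1$, then $\liminf_{n\to\infty}f(T^n(x))>0$ and $\limsup_{n\to\infty}f(T^n(x))<\frac{1-\ell_{\sup}(\alpha)}{1-\ell_{\inf}(\alpha)}$; (D$_2$) if $\ell_{\inf}(\alpha)=0$, then $\liminf_{n\to\infty}f(T^n(x))>0$, $\limsup_{n\to\infty}f(T^n(x))<1-p\cdot\ell_{\sup}(\alpha)$, and $\ell_{\sup}(\alpha)<1$. Then $$\frac{S_n-\mathbb{E}_x[S_n]}{a_nA_n}\xrightarrow{\ \mathcal{D}\ }\mathcal{N}(0,1)\quad\text{as }n\to\infty,$$ with convergence in distribution under $\mathbb{P}_x$, where $$a_n=\prod_{j=1}^{n-1}\Bigl(1+\frac{(2p-1)g(\alpha,j+1)}{j}\Bigr),\qquad A_n\ge0,\quad A_n^2=\sum_{k=1}^n\frac{1}{a_k^2}\bigl(1-\mathbb{E}_x[X_k]^2\bigr).$$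
   Context: Dynamic Elephant Random Walk (DERW). Let $(\mathcal{X},\mathscr{A},\mu)$ be a probability space and $T:\mathcal{X}\to\mathcal{X}$ a measurable $\mu$-preserving map ($\mu(T^{-1}A)=\mu(A)$ for all $A\in\mathscr{A}$); $T^n$ denotes the $n$-fold iterate. Let $f:\mathcal{X}\to[0,1]$ be $\mathscr{A}$-measurable. Let $p,q\in[0,1]$, let $g:R\subset\mathbb{R}\times\mathbb{N}\to[0,1]$ be a function and fix $\alpha\in\mathbb{R}$ with $(\alpha,n)\in R$ for all $n\ge1$; write $\alpha_n:=g(\alpha,n)\in[0,1]$. For $x\in\mathcal{X}$, the DERW under the probability $\mathbb{P}_x$ (expectation $\mathbb{E}_x$) is the process $S_0=0$, $S_n=\sum_{i=1}^n X_i$, with $\{-1,1\}$-valued increments such that $\mathbb{P}_x[X_1=1]=\alpha_1 q+(1-\alpha_1)f(Tx)$ and, for $n\ge1$, $\eta\in\{-1,1\}$, with $\mathscr{F}_n=\sigma(X_1,\dots,X_n)$, $$\mathbb{P}_x[X_{n+1}=\eta\mid\mathscr{F}_n]=\alpha_{n+1}\,\frac{1}{2n}\sum_{k=1}^{n}\bigl(1+(2p-1)X_k\eta\bigr)+(1-\alpha_{n+1})\,d_{n+1}(\eta),$$ where $d_m(1)=f(T^m x)$ and $d_m(-1)=1-f(T^m x)$. Standing assumption: the case where both $g(\alpha,2)=1$ and $p=0$ is excluded (so that $a_n>0$ for all $n$; $a_1=1$ as an empty product). *)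

theory Defs
  imports "HOL-Probability.Probability"
begin

definition natural_filtration :: "'w measure \<Rightarrow> (nat \<Rightarrow> 'w \<Rightarrow> real) \<Rightarrow> nat \<Rightarrow> 'w measure" where
  "natural_filtration M X n =
     sigma (space M) (\<Union>i\<in>{1..n}. {X i -` B \<inter> space M | B. B \<in> sets borel})"

text \<open>The dynamic part of the step law: \<open>d m 1 = f (T^m x)\<close> and \<open>d m (-1) = 1 - f (T^m x)\<close>.
  It is only ever used with \<open>\<eta> \<in> {-1, 1}\<close>.\<close>

definition dyn_prob :: "('x \<Rightarrow> 'x) \<Rightarrow> ('x \<Rightarrow> real) \<Rightarrow> 'x \<Rightarrow> nat \<Rightarrow> real \<Rightarrow> real" where
  "dyn_prob T f x m \<eta> = (if \<eta> = 1 then f ((T ^^ m) x) else 1 - f ((T ^^ m) x))"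

text \<open>The increments are \<open>X 1, X 2, \<dots>\<close>; \<open>X 0\<close> and the values of \<open>g\<close> outside \<open>R\<close> are irrelevant.
  The conditional probability of an event is the conditional expectation of its indicator.\<close>

locale derw = prob_space \<mu>
  for \<mu> :: "'x measure" +
  fixes T :: "'x \<Rightarrow> 'x" and f :: "'x \<Rightarrow> real"
    and p q :: real
    and R :: "(real \<times> nat) set" and g :: "real \<times> nat \<Rightarrow> real" and \<alpha> :: real
    and P :: "'x \<Rightarrow> 'w measure" and X :: "nat \<Rightarrow> 'w \<Rightarrow> real"
  assumes T_measurable: "T \<in> measurable \<mu> \<mu>"
    and T_preserving: "\<And>A. A \<in> sets \<mu> \<Longrightarrow> emeasure \<mu> (T -` A \<inter> space \<mu>) = emeasure \<mu> A"
    and f_measurable: "f \<in> borel_measurable \<mu>"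
    and f_range: "f \<in> space \<mu> \<rightarrow> {0..1}"
    and p_range: "p \<in> {0..1}"
    and q_range: "q \<in> {0..1}"
    and g_range: "g \<in> R \<rightarrow> {0..1}"
    and alpha_dom: "\<And>n. n \<ge> 1 \<Longrightarrow> (\<alpha>, n) \<in> R"
    and non_degenerate: "\<not> (g (\<alpha>, 2) = 1 \<and> p = 0)"
    and prob_space_P: "\<And>x. x \<in> space \<mu> \<Longrightarrow> prob_space (P x)"
    and X_measurable: "\<And>x i. x \<in> space \<mu> \<Longrightarrow> i \<ge> 1 \<Longrightarrow> X i \<in> borel_measurable (P x)"
    and X_values: "\<And>x i \<omega>. x \<in> space \<mu> \<Longrightarrow> i \<ge> 1 \<Longrightarrow> \<omega> \<in> space (P x) \<Longrightarrow> X i \<omega> \<in> {-1, 1}"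
    and first_step: "\<And>x. x \<in> space \<mu> \<Longrightarrow>
      measure (P x) {\<omega> \<in> space (P x). X 1 \<omega> = 1} = g (\<alpha>, 1) * q + (1 - g (\<alpha>, 1)) * f (T x)"
    and next_step: "\<And>x n \<eta>. x \<in> space \<mu> \<Longrightarrow> n \<ge> 1 \<Longrightarrow> \<eta> \<in> {-1, 1} \<Longrightarrow>
      AE \<omega> in P x.
        real_cond_exp (P x) (natural_filtration (P x) X n)
            (indicat_real {\<omega>' \<in> space (P x). X (n + 1) \<omega>' = \<eta>}) \<omega>
        = g (\<alpha>, n + 1) * (1 / (2 * real n) * (\<Sum>k=1..n. 1 + (2 * p - 1) * X k \<omega> * \<eta>))
          + (1 - g (\<alpha>, n + 1)) * dyn_prob T f x (n + 1) \<eta>"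

definition derw_S :: "(nat \<Rightarrow> 'w \<Rightarrow> real) \<Rightarrow> nat \<Rightarrow> 'w \<Rightarrow> real" where
  "derw_S X n \<omega> = (\<Sum>i=1..n. X i \<omega>)"

text \<open>\<open>liminf\<close> and \<open>limsup\<close> need a complete lattice, hence the detour through \<open>ereal\<close>. For
  \<open>n \<ge> 1\<close> the values \<open>g (\<alpha>, n)\<close> lie in \<open>[0, 1]\<close>, so both limits are finite and
  \<open>real_of_ereal\<close> does not alter them.\<close>

definition ell_inf :: "(real \<times> nat \<Rightarrow> real) \<Rightarrow> real \<Rightarrow> real" where
  "ell_inf g \<alpha> = real_of_ereal (liminf (\<lambda>n. ereal (g (\<alpha>, n))))"

definition ell_sup :: "(real \<times> nat \<Rightarrow> real) \<Rightarrow> real \<Rightarrow> real" where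
  "ell_sup g \<alpha> = real_of_ereal (limsup (\<lambda>n. ereal (g (\<alpha>, n))))"

definition derw_a :: "real \<Rightarrow> (real \<times> nat \<Rightarrow> real) \<Rightarrow> real \<Rightarrow> nat \<Rightarrow> real" where
  "derw_a p g \<alpha> n = (\<Prod>j\<in>{1..<n}. 1 + (2 * p - 1) * g (\<alpha>, j + 1) / real j)"

definition derw_A ::
  "'w measure \<Rightarrow> (nat \<Rightarrow> 'w \<Rightarrow> real) \<Rightarrow> real \<Rightarrow> (real \<times> nat \<Rightarrow> real) \<Rightarrow> real \<Rightarrow> nat \<Rightarrow> real" where
  "derw_A M X p g \<alpha> n =
     sqrt (\<Sum>k=1..n. 1 / (derw_a p g \<alpha> k)\<^sup>2 * (1 - (integral\<^sup>L M (X k))\<^sup>2))"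

end

theory Submission
  imports Defs "HOL-Real_Asymp.Real_Asymp"
begin

text \<open>The centred walk divided by \<open>a n\<close> is a martingale with increments
  \<open>(X n - E[X n | F (n-1)]) / a n\<close>. Both regimes of the hypothesis force the memory coefficient
  \<open>c n = (2 p - 1) g (\<alpha>, n + 1)\<close> to be at most \<open>1/2\<close> eventually, so \<open>(a n)\<^sup>2 = O(n)\<close>, the variance
  of \<open>S n\<close> is \<open>O(n powr (3/2))\<close>, and the conditional means of the increments approach the plain means
  in \<open>L\<^sup>1\<close>. The conditions D1 and D2 keep the means \<open>E[X n]\<close> away from \<open>1\<close> and \<open>-1\<close>, so \<open>(A n)\<^sup>2\<close> is
  comparable to \<open>\<Sum> 1 / (a k)\<^sup>2\<close>, which diverges. The characteristic function of the martingale is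
  compared step by step with that of a Gaussian walk having the deterministic variances
  \<open>(1 - E[X k]\<^sup>2) / (a k)\<^sup>2\<close>; the accumulated error is a weighted Cesaro mean of a null sequence, and
  Levy's continuity theorem applies.\<close>

section \<open>Elementary estimates: weighted means, Taylor bounds, a growth recursion\<close>

text \<open>The first \<open>K\<close> terms contribute the fixed amount \<open>H\<close>, which the
  diverging total weight outgrows; the later terms contribute at most \<open>\<epsilon> / 2\<close>
  times the total weight.\<close>

lemma weighted_cesaro:
  fixes w r :: "nat \<Rightarrow> real"
  assumes nonneg: "\<And>k. 0 \<le> w k"
    and div: "filterlim (\<lambda>n. \<Sum>k<n. w k) at_top sequentially"
    and r: "r \<longlonglongrightarrow> 0"
  shows "(\<lambda>n. (\<Sum>k<n. w k * r k) / (\<Sum>k<n. w k)) \<longlonglongrightarrow> 0"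
proof (rule LIMSEQ_I)
  fix \<epsilon> :: real assume "0 < \<epsilon>"
  then obtain K where K: "\<And>k. k \<ge> K \<Longrightarrow> \<bar>r k\<bar> \<le> \<epsilon> / 2"
    using LIMSEQ_D[OF r, of "\<epsilon> / 2"] by (auto intro: less_imp_le)
  define H where "H = (\<Sum>k<K. w k * \<bar>r k\<bar>)"
  have "\<forall>\<^sub>F n in sequentially. 2 * H / \<epsilon> + 1 \<le> (\<Sum>k<n. w k)"
    using div unfolding filterlim_at_top by blast
  then obtain N where N: "\<And>n. n \<ge> N \<Longrightarrow> 2 * H / \<epsilon> + 1 \<le> (\<Sum>k<n. w k)"
    unfolding eventually_sequentially by blast
  have "0 \<le> H" unfolding H_def by (intro sum_nonneg mult_nonneg_nonneg nonneg) auto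
  have "norm ((\<Sum>k<n. w k * r k) / (\<Sum>k<n. w k) - 0) < \<epsilon>" if "n \<ge> max N K" for n
  proof -
    let ?C = "\<Sum>k<n. w k"
    have C: "2 * H / \<epsilon> + 1 \<le> ?C" using N that by simp
    then have "0 < ?C" using \<open>0 \<le> H\<close> \<open>0 < \<epsilon>\<close> by (smt (verit) divide_nonneg_pos)
    have "\<bar>\<Sum>k<n. w k * r k\<bar> \<le> (\<Sum>k<n. w k * \<bar>r k\<bar>)"
      by (rule order_trans[OF sum_abs]) (simp add: abs_mult nonneg)
    also have "\<dots> = H + (\<Sum>k=K..<n. w k * \<bar>r k\<bar>)"
      unfolding H_def using that by (simp add: lessThan_atLeast0 sum.atLeastLessThan_concat)
    also have "\<dots> \<le> H + (\<Sum>k=K..<n. w k * (\<epsilon> / 2))"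
      by (intro add_left_mono sum_mono mult_left_mono K nonneg) auto
    also have "\<dots> \<le> H + (\<Sum>k<n. w k * (\<epsilon> / 2))"
      by (intro add_left_mono sum_mono2) (use nonneg \<open>0 < \<epsilon>\<close> in auto)
    also have "\<dots> = H + ?C * (\<epsilon> / 2)" by (simp add: sum_distrib_right)
    finally have "\<bar>\<Sum>k<n. w k * r k\<bar> \<le> H + ?C * (\<epsilon> / 2)" by simp
    also have "H < ?C * (\<epsilon> / 2)" using C \<open>0 < \<epsilon>\<close> by (simp add: field_simps)
    finally have "\<bar>\<Sum>k<n. w k * r k\<bar> < \<epsilon> * ?C" by simp
    then show ?thesis using \<open>0 < ?C\<close> by (simp add: abs_divide field_simps)
  qed
  then show "\<exists>N. \<forall>n\<ge>N. norm ((\<Sum>k<n. w k * r k) / (\<Sum>k<n. w k) - 0) < \<epsilon>" by blast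
qed


lemma exp_neg_bounds:
  fixes v :: real assumes "0 \<le> v"
  shows "\<bar>exp (- v) - (1 - v)\<bar> \<le> v\<^sup>2 / 2"
proof -
  have "1 - v \<le> exp (- v)" using exp_ge_add_one_self[of "- v"] by simp
  moreover have "exp (- v) \<le> 1 - v + v\<^sup>2 / 2"
  proof (cases "v = 0")
    case False
    obtain t where "\<bar>t\<bar> \<le> \<bar>- v\<bar>" "exp (- v) = (\<Sum>m<3. (- v) ^ m / fact m) + exp t / fact 3 * (- v) ^ 3"
      using Maclaurin_exp_le[of "- v" 3] by blast
    \<comment> \<open>The Lagrange remainder carries the factor \<open>(- v) ^ 3\<close>, so the
      quadratic Taylor polynomial overestimates \<open>exp (- v)\<close>.\<close>
    moreover have "exp t / fact 3 * (- v) ^ 3 \<le> 0"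
      using assms by (intro mult_nonneg_nonpos) auto
    ultimately show ?thesis by (simp add: eval_nat_numeral)
  qed simp
  ultimately show ?thesis by simp
qed

lemma iexp_second_order: "cmod (iexp x - (1 + \<i> * x - x\<^sup>2 / 2)) \<le> \<bar>x\<bar> ^ 3 / 6"
  using iexp_approx1[of x 2] by (simp add: eval_nat_numeral power2_eq_square field_simps)

text \<open>The weights are the probabilities of \<open>1\<close> and \<open>-1\<close> for a step
  of mean \<open>h\<close>, so the first expression is the characteristic function at
  \<open>s\<close> of the centred step; the exponential belongs to a centred Gaussian of variance
  \<open>1 - m\<^sup>2\<close>. Both are replaced by Taylor polynomials, and the two variances
  differ by at most \<open>2 * \<bar>h - m\<bar>\<close>.\<close>

lemma char_two_point:
  fixes h m s :: real
  assumes h: "\<bar>h\<bar> \<le> 1" and m: "\<bar>m\<bar> \<le> 1"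
  shows "cmod ((1 + h) / 2 * iexp (s * (1 - h)) + (1 - h) / 2 * iexp (- (s * (1 + h)))
           - exp (- (s\<^sup>2 * (1 - m\<^sup>2) / 2)))
         \<le> 4 / 3 * \<bar>s\<bar> ^ 3 + s ^ 4 / 8 + s\<^sup>2 * \<bar>h - m\<bar>"
proof -
  define T :: "real \<Rightarrow> complex" where "T x = 1 + \<i> * x - x\<^sup>2 / 2" for x
  \<comment> \<open>\<open>4 / 3\<close> is \<open>2 ^ 3 / 6\<close>: both exponents have modulus at
    most \<open>2 * \<bar>s\<bar>\<close>.\<close>
  have E: "cmod (iexp x - T x) \<le> 4 / 3 * \<bar>s\<bar> ^ 3" if "\<bar>x\<bar> \<le> 2 * \<bar>s\<bar>" for x
  proof -
    have "cmod (iexp x - T x) \<le> \<bar>x\<bar> ^ 3 / 6" using iexp_second_order unfolding T_def .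
    also have "\<bar>x\<bar> ^ 3 \<le> (2 * \<bar>s\<bar>) ^ 3" using that by (intro power_mono) auto
    finally show ?thesis by (simp add: power_mult_distrib)
  qed
  let ?x = "s * (1 - h)" and ?y = "- (s * (1 + h))"
  let ?v = "s\<^sup>2 * (1 - m\<^sup>2) / 2"
  have m1: "0 \<le> 1 - m\<^sup>2" "1 - m\<^sup>2 \<le> 1" using m by (auto simp: abs_square_le_1)
  have "0 \<le> ?v" using m1 by simp
  have x: "\<bar>?x\<bar> \<le> 2 * \<bar>s\<bar>" "\<bar>?y\<bar> \<le> 2 * \<bar>s\<bar>"
    using h by (auto simp: abs_mult mult.commute[of _ "\<bar>s\<bar>"] intro!: mult_left_mono)
  \<comment> \<open>The linear terms cancel because the step is centred; the quadratic ones give its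
    variance \<open>1 - h\<^sup>2\<close>.\<close>
  have T: "(1 + h) / 2 * T ?x + (1 - h) / 2 * T ?y = of_real (1 - s\<^sup>2 * (1 - h\<^sup>2) / 2)"
    unfolding T_def by (simp add: field_simps power2_eq_square)
  have A: "cmod ((1 + h) / 2 * (iexp ?x - T ?x) + (1 - h) / 2 * (iexp ?y - T ?y)) \<le> 4 / 3 * \<bar>s\<bar> ^ 3"
  proof -
    have "cmod (of_real ((1 + h) / 2) * (iexp ?x - T ?x) + of_real ((1 - h) / 2) * (iexp ?y - T ?y))
      \<le> (1 + h) / 2 * cmod (iexp ?x - T ?x) + (1 - h) / 2 * cmod (iexp ?y - T ?y)"
      by (rule order_trans[OF norm_triangle_ineq]) (use h in \<open>simp add: norm_mult del: of_real_add of_real_diff of_real_divide\<close>)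
    also have "\<dots> \<le> (1 + h) / 2 * (4 / 3 * \<bar>s\<bar> ^ 3) + (1 - h) / 2 * (4 / 3 * \<bar>s\<bar> ^ 3)"
      using h by (intro add_mono mult_left_mono E x) auto
    also have "\<dots> = 4 / 3 * \<bar>s\<bar> ^ 3" by (simp add: field_simps)
    finally show ?thesis by simp
  qed
  have B: "\<bar>exp (- ?v) - (1 - ?v)\<bar> \<le> s ^ 4 / 8"
  proof -
    have "?v\<^sup>2 \<le> (s\<^sup>2 / 2)\<^sup>2" using m1 \<open>0 \<le> ?v\<close>
      by (intro power_mono) (auto intro!: mult_left_le)
    then show ?thesis using exp_neg_bounds[OF \<open>0 \<le> ?v\<close>] by (simp add: power_divide flip: power_mult)
  qed
  have C: "\<bar>(1 - s\<^sup>2 * (1 - h\<^sup>2) / 2) - (1 - ?v)\<bar> \<le> s\<^sup>2 * \<bar>h - m\<bar>"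
  proof -
    have eq: "(1 - s\<^sup>2 * (1 - h\<^sup>2) / 2) - (1 - ?v) = s\<^sup>2 * ((h - m) * ((h + m) / 2))"
      by (simp add: field_simps power2_eq_square)
    have "\<bar>(h - m) * ((h + m) / 2)\<bar> \<le> \<bar>h - m\<bar> * 1"
      unfolding abs_mult using h m by (intro mult_left_mono) auto
    then show ?thesis
      unfolding eq abs_mult[of "s\<^sup>2"] by (intro mult_mono) auto
  qed
  \<comment> \<open>\<open>U'\<close> and \<open>V'\<close> are the Taylor polynomials,
    \<open>z\<close> is their weighted sum and \<open>w\<close> the linearised Gaussian value
    \<open>1 - ?v\<close>; the three resulting differences are bounded by \<open>A\<close>,
    \<open>C\<close> and \<open>B\<close>.\<close>
  have split: "u * U + v * V - e = (u * (U - U') + v * (V - V')) + ((z - w) - (e - w))"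
    if "u * U' + v * V' = z" for u v U V U' V' e z w :: complex
    unfolding that[symmetric] by (simp add: algebra_simps)
  have tri: "cmod (P + of_real (Q - R)) \<le> cmod P + (\<bar>Q\<bar> + \<bar>R\<bar>)" for P and Q R :: real
    using norm_triangle_ineq[of P "of_real (Q - R)"] by (simp only: norm_of_real)
  have "cmod (((1 + h) / 2) * iexp ?x + ((1 - h) / 2) * iexp ?y - exp (- ?v))
    \<le> 4 / 3 * \<bar>s\<bar> ^ 3 + (s\<^sup>2 * \<bar>h - m\<bar> + s ^ 4 / 8)"
    unfolding split[OF T, of _ _ _ "of_real (1 - ?v)"] of_real_diff[symmetric]
    by (rule order_trans[OF tri]) (intro add_mono A B C)
  then show ?thesis by (simp only: ac_simps)
qed

text \<open>A supersolution argument: \<open>n - 1 / 2\<close> dominates the homogeneous recursion,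
  and the growth of the factor \<open>w + 2 * d * sqrt n\<close> pays for the source
  \<open>d\<close>. It is applied with \<open>d = 0\<close> to the squared normalising constants and
  with \<open>d = 4\<close> to the second moment of the centred walk.\<close>

lemma half_growth_bound:
  fixes u :: "nat \<Rightarrow> real"
  assumes K: "1 \<le> K" and u: "\<And>n. 0 \<le> u n" and d: "0 \<le> d"
    and step: "\<And>n. K \<le> n \<Longrightarrow> u (Suc n) \<le> (1 + 1 / (2 * real n))\<^sup>2 * u n + d"
  obtains w where "0 \<le> w" "\<And>n. K \<le> n \<Longrightarrow> u n \<le> real n * (w + 2 * d * sqrt (real n))"
proof
  define w where "w = u K / (real K - 1 / 2)"
  show w: "0 \<le> w" using K u unfolding w_def by simp
  have main: "u n \<le> (real n - 1 / 2) * (w + 2 * d * sqrt (real n))" if "K \<le> n" for n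
    using that
  proof (induction n rule: dec_induct)
    case base
    have "u K = (real K - 1 / 2) * w" using K by (simp add: w_def)
    also have "\<dots> \<le> (real K - 1 / 2) * (w + 2 * d * sqrt (real K))"
      using K d by (intro mult_left_mono) auto
    finally show ?case .
  next
    case (step n)
    have n: "1 \<le> n" using K step.hyps by simp
    let ?g = "w + 2 * d * sqrt (real n)"
    have g: "0 \<le> ?g" using w d by simp
    \<comment> \<open>The shift by \<open>1 / 2\<close> makes the linear function a supersolution:
      multiplying out leaves a factor below \<open>1\<close>.\<close>
    have "(1 + 1 / (2 * real n))\<^sup>2 * (real n - 1 / 2) = (real n + 1 / 2) * (1 - 1 / (4 * (real n)\<^sup>2))"
      using n by (simp add: field_simps power2_eq_square)
    also have "\<dots> \<le> real n + 1 / 2" by (intro mult_left_le) auto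
    finally have f: "(1 + 1 / (2 * real n))\<^sup>2 * (real n - 1 / 2) \<le> real n + 1 / 2" .
    \<comment> \<open>The sum and the difference of the two roots multiply to \<open>1\<close>, and
      the sum is at most \<open>2 * (n + 1 / 2)\<close>.\<close>
    have r: "1 \<le> 2 * (real n + 1 / 2) * (sqrt (real (Suc n)) - sqrt (real n))"
    proof -
      let ?p = "sqrt (real (Suc n))" and ?q = "sqrt (real n)"
      have "?p \<le> real n + 1 / 2"
        using n mult_mono[of 1 "real n" 1 "real n"] by (intro real_le_lsqrt) (auto simp: power2_eq_square algebra_simps)
      from add_mono[OF this order_trans[OF _ this]]
      have "?p + ?q \<le> 2 * (real n + 1 / 2)" by simp
      moreover have "0 \<le> ?p - ?q" by simp
      ultimately have "(?p + ?q) * (?p - ?q) \<le> 2 * (real n + 1 / 2) * (?p - ?q)"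
        by (rule mult_right_mono)
      moreover have "(?p + ?q) * (?p - ?q) = 1" by (simp add: algebra_simps)
      ultimately show ?thesis by (simp only:)
    qed
    have "u (Suc n) \<le> (1 + 1 / (2 * real n))\<^sup>2 * u n + d" using assms(4) step.hyps by simp
    also have "\<dots> \<le> (1 + 1 / (2 * real n))\<^sup>2 * ((real n - 1 / 2) * ?g) + d"
      by (intro add_right_mono mult_left_mono step.IH) simp
    also have "\<dots> = ((1 + 1 / (2 * real n))\<^sup>2 * (real n - 1 / 2)) * ?g + d" by simp
    also have "\<dots> \<le> (real n + 1 / 2) * ?g + d"
      by (intro add_right_mono mult_right_mono f g)
    also have "\<dots> \<le> (real n + 1 / 2) * ?g + d * (2 * (real n + 1 / 2) * (sqrt (real (Suc n)) - sqrt (real n)))"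
      using mult_left_mono[OF r d] by simp
    also have "\<dots> = (real (Suc n) - 1 / 2) * (w + 2 * d * sqrt (real (Suc n)))"
      by (simp add: algebra_simps)
    finally show ?case .
  qed
  show "u n \<le> real n * (w + 2 * d * sqrt (real n))" if "K \<le> n" for n
    by (rule order_trans[OF main[OF that]]) (use w d in \<open>intro mult_right_mono, auto\<close>)
qed

section \<open>The natural filtration\<close>

lemma subalgebra_natural_filtration:
  assumes "\<And>i. i \<ge> 1 \<Longrightarrow> X i \<in> borel_measurable M"
  shows "subalgebra M (natural_filtration M X n)"
proof -
  have "(\<Union>i\<in>{1..n}. {X i -` B \<inter> space M |B. B \<in> sets borel}) \<subseteq> sets M"
    using assms by (auto intro: measurable_sets)
  then show ?thesis
    unfolding subalgebra_def natural_filtration_def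
    by (auto simp: space_measure_of_conv sets_measure_of_conv dest: sets.sigma_sets_subset)
qed

text \<open>At time \<open>0\<close> there are no generators, so the sigma-algebra is trivial and
  the level set of an attained value is the whole space. This lets the first step be treated like
  the conditional ones.\<close>

lemma (in prob_space) natural_filtration_0_constant:
  fixes Z :: "'a \<Rightarrow> real"
  assumes Z: "Z \<in> borel_measurable (natural_filtration M X 0)"
  obtains z where "\<And>\<omega>. \<omega> \<in> space M \<Longrightarrow> Z \<omega> = z"
proof -
  obtain \<omega>\<^sub>0 where \<omega>\<^sub>0: "\<omega>\<^sub>0 \<in> space M" using not_empty by blast
  have "Z -` {Z \<omega>\<^sub>0} \<inter> space (natural_filtration M X 0) \<in> sets (natural_filtration M X 0)"
    by (rule measurable_sets[OF Z]) simp
  then have "Z -` {Z \<omega>\<^sub>0} \<inter> space M \<in> {{}, space M}"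
    by (simp add: natural_filtration_def space_measure_of_conv sets_measure_of_conv sigma_sets_empty_eq)
  then show ?thesis using \<omega>\<^sub>0 by (intro that[of "Z \<omega>\<^sub>0"]) auto
qed

section \<open>Walks whose conditional step mean is affine in the average of the past steps\<close>

text \<open>\<open>step_mean\<close> is the conditional mean formula in weak form, tested against
  bounded functions of the past, so that later arguments need only plain integrals. At
  \<open>n = 0\<close> the quotient by zero is \<open>0\<close> and the formula reads: the first
  step has mean \<open>b 0\<close>.\<close>

locale linear_step_walk = prob_space M
  for M :: "'w measure" +
  fixes X :: "nat \<Rightarrow> 'w \<Rightarrow> real" and c b :: "nat \<Rightarrow> real"
  assumes X_measurable: "\<And>i. i \<ge> 1 \<Longrightarrow> X i \<in> borel_measurable M"
    and X_values: "\<And>i \<omega>. i \<ge> 1 \<Longrightarrow> \<omega> \<in> space M \<Longrightarrow> X i \<omega> \<in> {-1, 1}"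
    and drift_bound: "\<And>n. \<bar>c n\<bar> + \<bar>b n\<bar> \<le> 1"
    and factor_pos: "\<And>n. 0 < 1 + c n / real n"
    and step_mean: "\<And>n Z K. Z \<in> borel_measurable (natural_filtration M X n) \<Longrightarrow>
      (\<And>\<omega>. \<omega> \<in> space M \<Longrightarrow> \<bar>Z \<omega>\<bar> \<le> K) \<Longrightarrow>
      expectation (\<lambda>\<omega>. Z \<omega> * X (Suc n) \<omega>)
        = expectation (\<lambda>\<omega>. Z \<omega> * (c n * ((\<Sum>i<n. X (Suc i) \<omega>) / real n) + b n))"
begin

abbreviation F :: "nat \<Rightarrow> 'w measure" where "F \<equiv> natural_filtration M X"

definition S :: "nat \<Rightarrow> 'w \<Rightarrow> real" where "S n \<omega> = (\<Sum>i<n. X (Suc i) \<omega>)"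
definition Y :: "nat \<Rightarrow> 'w \<Rightarrow> real" where "Y n \<omega> = S n \<omega> - expectation (S n)"
text \<open>A version of the conditional mean of \<open>X (Suc n)\<close> given
  \<open>F n\<close>.\<close>

definition h :: "nat \<Rightarrow> 'w \<Rightarrow> real" where "h n \<omega> = c n * (S n \<omega> / real n) + b n"
definition a :: "nat \<Rightarrow> real" where "a n = (\<Prod>j\<in>{1..<n}. 1 + c j / real j)"

section \<open>Measurability, boundedness and integrability\<close>

lemma subalgebra_F: "subalgebra M (F n)"
  by (rule subalgebra_natural_filtration[OF X_measurable])

lemma F_measurable_M: "Z \<in> measurable (F n) N \<Longrightarrow> Z \<in> measurable M N"
  by (rule measurable_from_subalg[OF subalgebra_F])

lemma X_measurable_F: "1 \<le> i \<Longrightarrow> i \<le> n \<Longrightarrow> X i \<in> borel_measurable (F n)"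
  unfolding natural_filtration_def
  by (rule measurableI) (force simp: space_measure_of_conv intro!: in_measure_of)+

lemma S_measurable_F [measurable]: "S n \<in> borel_measurable (F n)"
  unfolding S_def[abs_def] by (intro borel_measurable_sum X_measurable_F) auto

lemma Y_measurable_F [measurable]: "Y n \<in> borel_measurable (F n)"
  unfolding Y_def[abs_def] by measurable

lemma h_measurable_F [measurable]: "h n \<in> borel_measurable (F n)"
  unfolding h_def[abs_def] by measurable

lemmas SYh_measurable [measurable] =
  S_measurable_F[THEN F_measurable_M] Y_measurable_F[THEN F_measurable_M]
  h_measurable_F[THEN F_measurable_M]

lemma X_Suc_measurable [measurable]: "X (Suc n) \<in> borel_measurable M"
  by (simp add: X_measurable)

lemma integrable_bounded:
  fixes Z :: "'w \<Rightarrow> 'b::{banach, second_countable_topology}"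
  assumes "Z \<in> borel_measurable M" "\<And>\<omega>. \<omega> \<in> space M \<Longrightarrow> norm (Z \<omega>) \<le> K"
  shows "integrable M Z"
  using assms by (intro integrable_const_bound[of _ K]) auto

lemma X_abs: "\<omega> \<in> space M \<Longrightarrow> \<bar>X (Suc n) \<omega>\<bar> = 1"
  using X_values[of "Suc n" \<omega>] by auto

lemma S_bound: assumes "\<omega> \<in> space M" shows "\<bar>S n \<omega>\<bar> \<le> real n"
proof -
  have "\<bar>S n \<omega>\<bar> \<le> (\<Sum>i<n. \<bar>X (Suc i) \<omega>\<bar>)" unfolding S_def by (rule sum_abs)
  then show ?thesis using assms by (simp add: X_abs)
qed

lemma integrable_X: "integrable M (X (Suc n))"
  by (rule integrable_bounded[where K=1]) (auto simp: X_abs)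

lemma integrable_S: "integrable M (S n)"
  by (rule integrable_bounded[where K="real n"]) (auto simp: S_bound)

lemma expectation_S: "expectation (S n) = (\<Sum>i<n. expectation (X (Suc i)))"
  unfolding S_def[abs_def] by (intro Bochner_Integration.integral_sum integrable_X)

lemma expectation_abs_le:
  fixes Z :: "'w \<Rightarrow> real"
  assumes "integrable M Z" "\<And>\<omega>. \<omega> \<in> space M \<Longrightarrow> \<bar>Z \<omega>\<bar> \<le> K"
  shows "\<bar>expectation Z\<bar> \<le> K"
proof -
  have "\<bar>expectation Z\<bar> \<le> expectation (\<lambda>\<omega>. \<bar>Z \<omega>\<bar>)" using integral_norm_bound[of M Z] by simp
  also have "\<dots> \<le> K" using assms by (intro integral_le_const integrable_abs) auto
  finally show ?thesis .
qed

lemma expectation_X_bound: "\<bar>expectation (X (Suc n))\<bar> \<le> 1"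
  by (rule expectation_abs_le[OF integrable_X]) (simp add: X_abs)

lemma expectation_S_bound: "\<bar>expectation (S n)\<bar> \<le> real n"
  by (rule expectation_abs_le[OF integrable_S S_bound])

lemma Y_bound: assumes "\<omega> \<in> space M" shows "\<bar>Y n \<omega>\<bar> \<le> 2 * real n"
  using S_bound[OF assms, of n] expectation_S_bound[of n] unfolding Y_def by linarith

lemma integrable_Y: "integrable M (Y n)"
  by (rule integrable_bounded[where K="2 * real n"]) (auto simp: Y_bound)

lemma linear_drift_bound: assumes "\<bar>r\<bar> \<le> real n" shows "\<bar>c n * (r / real n) + b n\<bar> \<le> 1"
proof -
  have "\<bar>r / real n\<bar> \<le> 1" using assms by (cases "n = 0") (auto simp: abs_divide)
  then have "\<bar>c n * (r / real n)\<bar> \<le> \<bar>c n\<bar> * 1" unfolding abs_mult[of "c n"] by (rule mult_left_mono) simp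
  then show ?thesis using drift_bound[of n] by linarith
qed

lemma h_bound: "\<omega> \<in> space M \<Longrightarrow> \<bar>h n \<omega>\<bar> \<le> 1"
  unfolding h_def by (intro linear_drift_bound S_bound)

section \<open>Conditional means, the martingale recursion and second moments\<close>

lemma step_mean_h:
  assumes "Z \<in> borel_measurable (F n)" "\<And>\<omega>. \<omega> \<in> space M \<Longrightarrow> \<bar>Z \<omega>\<bar> \<le> K"
  shows "expectation (\<lambda>\<omega>. Z \<omega> * X (Suc n) \<omega>) = expectation (\<lambda>\<omega>. Z \<omega> * h n \<omega>)"
  using step_mean[OF assms] unfolding h_def S_def .

text \<open>The test functions for characteristic functions are complex; their real and imaginary
  parts are admissible separately.\<close>

lemma step_mean_complex:
  fixes Z :: "'w \<Rightarrow> complex"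
  assumes Z [measurable]: "Z \<in> borel_measurable (F n)"
    and K: "\<And>\<omega>. \<omega> \<in> space M \<Longrightarrow> cmod (Z \<omega>) \<le> K"
  shows "(CLINT \<omega>|M. Z \<omega> * X (Suc n) \<omega>) = (CLINT \<omega>|M. Z \<omega> * h n \<omega>)"
proof -
  note [measurable] = F_measurable_M[OF Z]
  have I: "integrable M (\<lambda>\<omega>. Z \<omega> * X (Suc n) \<omega>)" "integrable M (\<lambda>\<omega>. Z \<omega> * h n \<omega>)"
    by (rule integrable_bounded[where K="K * 1"], measurable,
        unfold norm_mult norm_of_real, intro mult_mono K,
        auto simp: X_abs h_bound intro: order_trans[OF norm_ge_zero K])+
  have "expectation (\<lambda>\<omega>. Re (Z \<omega>) * X (Suc n) \<omega>) = expectation (\<lambda>\<omega>. Re (Z \<omega>) * h n \<omega>)"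
    using K by (intro step_mean_h[where K=K]) (auto intro: order_trans[OF abs_Re_le_cmod])
  moreover have "expectation (\<lambda>\<omega>. Im (Z \<omega>) * X (Suc n) \<omega>) = expectation (\<lambda>\<omega>. Im (Z \<omega>) * h n \<omega>)"
    using K by (intro step_mean_h[where K=K]) (auto intro: order_trans[OF abs_Im_le_cmod])
  ultimately show ?thesis
    using integral_Re[OF I(1)] integral_Re[OF I(2)] integral_Im[OF I(1)] integral_Im[OF I(2)]
    by (intro complex_eqI) simp_all
qed

lemma expectation_X_Suc:
  "expectation (X (Suc n)) = c n * (expectation (S n) / real n) + b n"
proof -
  have "expectation (X (Suc n)) = expectation (h n)"
    using step_mean_h[of "\<lambda>_. 1" n 1] by simp
  also have "\<dots> = c n * (expectation (S n) / real n) + b n"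
    unfolding h_def[abs_def] using integrable_S by (simp add: prob_space)
  finally show ?thesis .
qed

text \<open>The memory is linear and \<open>b n\<close> cancels, so the conditional mean approaches
  the plain mean as soon as \<open>Y n / n\<close> is small.\<close>

lemma h_deviation: "h n \<omega> - expectation (X (Suc n)) = c n * (Y n \<omega> / real n)"
  unfolding expectation_X_Suc h_def Y_def by (simp add: algebra_simps diff_divide_distrib)

text \<open>The martingale structure: the factor is the quotient of consecutive values of
  \<open>a\<close>, so \<open>Y / a\<close> has the differences
  \<open>(X (Suc n) - h n) / a (Suc n)\<close>.\<close>

lemma Y_Suc: "Y (Suc n) \<omega> = (1 + c n / real n) * Y n \<omega> + (X (Suc n) \<omega> - h n \<omega>)"
proof -
  have "Y (Suc n) \<omega> = Y n \<omega> + (X (Suc n) \<omega> - expectation (X (Suc n)))"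
    unfolding Y_def expectation_S by (simp add: S_def)
  also have "\<dots> = (1 + c n / real n) * Y n \<omega> + (X (Suc n) \<omega> - h n \<omega>)"
    using h_deviation[of n \<omega>] by (simp add: algebra_simps)
  finally show ?thesis .
qed

text \<open>On squaring the recursion the cross term vanishes, since \<open>X (Suc n) - h n\<close>
  is orthogonal to bounded functions of the past; \<open>4\<close> bounds its square.\<close>

lemma second_moment_Suc:
  "expectation (\<lambda>\<omega>. (Y (Suc n) \<omega>)\<^sup>2) \<le> (1 + c n / real n)\<^sup>2 * expectation (\<lambda>\<omega>. (Y n \<omega>)\<^sup>2) + 4"
proof -
  let ?\<gamma> = "1 + c n / real n"
  have i1: "integrable M (\<lambda>\<omega>. (Y n \<omega>)\<^sup>2)"
    using power_mono[OF Y_bound abs_ge_zero, of _ n 2]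
    by (intro integrable_bounded[where K="(2 * real n)\<^sup>2"]) auto
  have i2: "integrable M (\<lambda>\<omega>. Y n \<omega> * X (Suc n) \<omega>)" "integrable M (\<lambda>\<omega>. Y n \<omega> * h n \<omega>)"
    by (rule integrable_bounded[where K="2 * real n * 1"], measurable,
        unfold real_norm_def abs_mult, intro mult_mono Y_bound, auto simp: X_abs h_bound)+
  have D: "(X (Suc n) \<omega> - h n \<omega>)\<^sup>2 \<le> 4" if "\<omega> \<in> space M" for \<omega>
  proof -
    have "\<bar>X (Suc n) \<omega> - h n \<omega>\<bar> \<le> 2" using X_abs[OF that, of n] h_bound[OF that, of n] by linarith
    then show ?thesis using power_mono[of "\<bar>X (Suc n) \<omega> - h n \<omega>\<bar>" 2 2] by simp
  qed
  have i3: "integrable M (\<lambda>\<omega>. (X (Suc n) \<omega> - h n \<omega>)\<^sup>2)"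
    by (rule integrable_bounded[where K=4]) (auto simp: D)
  have "expectation (\<lambda>\<omega>. (Y (Suc n) \<omega>)\<^sup>2) = expectation (\<lambda>\<omega>. ?\<gamma>\<^sup>2 * (Y n \<omega>)\<^sup>2
      + 2 * ?\<gamma> * (Y n \<omega> * X (Suc n) \<omega> - Y n \<omega> * h n \<omega>) + (X (Suc n) \<omega> - h n \<omega>)\<^sup>2)"
    unfolding Y_Suc by (intro Bochner_Integration.integral_cong) (auto simp: power2_eq_square algebra_simps)
  also have "\<dots> = ?\<gamma>\<^sup>2 * expectation (\<lambda>\<omega>. (Y n \<omega>)\<^sup>2)
      + 2 * ?\<gamma> * (expectation (\<lambda>\<omega>. Y n \<omega> * X (Suc n) \<omega>) - expectation (\<lambda>\<omega>. Y n \<omega> * h n \<omega>))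
      + expectation (\<lambda>\<omega>. (X (Suc n) \<omega> - h n \<omega>)\<^sup>2)"
    using i1 i2 i3 by simp
  also have "expectation (\<lambda>\<omega>. Y n \<omega> * X (Suc n) \<omega>) = expectation (\<lambda>\<omega>. Y n \<omega> * h n \<omega>)"
    by (rule step_mean_h[OF Y_measurable_F Y_bound])
  also have "expectation (\<lambda>\<omega>. (X (Suc n) \<omega> - h n \<omega>)\<^sup>2) \<le> 4"
    using i3 D by (intro integral_le_const) auto
  finally show ?thesis by simp
qed

section \<open>Growth of the normalising constants and divergence of the variance weights\<close>

lemma a_Suc: "a (Suc n) = a n * (1 + c n / real n)"
  by (cases "n = 0") (auto simp: a_def)

lemma a_pos: "0 < a n"
  unfolding a_def by (intro prod_pos factor_pos)

text \<open>The weight of the step \<open>X (Suc k)\<close> in the variance, hence the index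
  shift.\<close>

definition W :: "nat \<Rightarrow> real" where "W k = 1 / (a (Suc k))\<^sup>2"

lemma W_pos: "0 < W k" using a_pos[of "Suc k"] by (simp add: W_def)

lemma square_factor_le:
  assumes "c n \<le> 1 / 2" "1 \<le> n"
  shows "(1 + c n / real n)\<^sup>2 \<le> (1 + 1 / (2 * real n))\<^sup>2"
proof -
  have "c n / real n \<le> (1 / 2) / real n" using assms by (intro divide_right_mono) auto
  then show ?thesis using factor_pos[of n] by (intro power_mono) auto
qed

text \<open>The right-hand quantity \<open>u n\<close> obeys \<open>u (n + 1) = (1 + c n / n)\<^sup>2 * u n + 1\<close>; it grows most slowly
  for \<open>c = -1\<close>, where the recursion still propagates \<open>u n \<ge> n / 3\<close>.\<close>

lemma a_square_sum_W: "real n / 3 \<le> (a n)\<^sup>2 * (\<Sum>k<n. W k)"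
proof (induction n)
  case (Suc n)
  have "(a (Suc n))\<^sup>2 * (\<Sum>k<Suc n. W k)
      = (1 + c n / real n)\<^sup>2 * ((a n)\<^sup>2 * (\<Sum>k<n. W k)) + (a (Suc n))\<^sup>2 * W n"
    unfolding a_Suc power_mult_distrib sum.lessThan_Suc by (simp only: distrib_left distrib_right mult_ac add_ac)
  moreover have "(a (Suc n))\<^sup>2 * W n = 1" using a_pos[of "Suc n"] by (simp add: W_def)
  \<comment> \<open>The last summand contributes exactly \<open>1\<close>, so a loss of
    \<open>2 / 3\<close> still leaves \<open>(n + 1) / 3\<close>.\<close>
  moreover have "real n / 3 - 2 / 3 \<le> (1 + c n / real n)\<^sup>2 * ((a n)\<^sup>2 * (\<Sum>k<n. W k))"
  proof (cases "n = 0")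
    case False
    have "1 - 1 / real n \<le> 1 + c n / real n"
      using drift_bound[of n] False divide_right_mono[of "-1" "c n" "real n"] by simp
    moreover have "0 \<le> 1 - 1 / real n" using False by simp
    ultimately have "(1 - 1 / real n)\<^sup>2 \<le> (1 + c n / real n)\<^sup>2" by (rule power_mono)
    then have "(1 - 1 / real n)\<^sup>2 * (real n / 3) \<le> (1 + c n / real n)\<^sup>2 * ((a n)\<^sup>2 * (\<Sum>k<n. W k))"
      by (intro mult_mono Suc.IH) auto
    moreover have "(1 - 1 / real n)\<^sup>2 * (real n / 3) = real n / 3 - 2 / 3 + 1 / (3 * real n)"
      using False by (simp add: field_simps power2_eq_square)
    moreover have "0 \<le> 1 / (3 * real n)" by simp
    ultimately show ?thesis by linarith
  qed simp
  ultimately show ?case by simp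
qed simp

text \<open>The preceding bound, taken at \<open>Suc k\<close>, compares \<open>W k\<close> with the
  sum of the weights up to \<open>k\<close>. This is the negligibility condition: no single step
  carries more than the share \<open>3 / (k + 1)\<close> of the total weight.\<close>

lemma W_le: assumes "k < n" shows "W k \<le> 3 / real (Suc k) * (\<Sum>k<n. W k)"
proof -
  have "real (Suc k) * W k \<le> 3 * (\<Sum>k<Suc k. W k)"
    using a_square_sum_W[of "Suc k"] a_pos[of "Suc k"] unfolding W_def[of k]
    by (simp add: field_simps del: sum.lessThan_Suc)
  also have "\<dots> \<le> 3 * (\<Sum>k<n. W k)"
    using assms by (intro mult_left_mono sum_mono2) (auto simp: less_imp_le[OF W_pos])
  finally show ?thesis by (simp add: field_simps)
qed

text \<open>Memory at most \<open>1 / 2\<close> gives \<open>(a n)\<^sup>2 \<le> n * w\<close>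
  eventually, so the weights dominate a multiple of the harmonic series.\<close>

lemma sum_W_at_top:
  assumes "\<forall>\<^sub>F n in sequentially. c n \<le> 1 / 2"
  shows "filterlim (\<lambda>n. \<Sum>k<n. W k) at_top sequentially"
proof -
  obtain K where K: "1 \<le> K" "\<And>n. K \<le> n \<Longrightarrow> c n \<le> 1 / 2"
    using eventually_conj[OF assms eventually_ge_at_top[of 1]]
    unfolding eventually_sequentially by (metis dual_order.trans le_refl)
  obtain w where w: "0 \<le> w" "\<And>n. K \<le> n \<Longrightarrow> (a n)\<^sup>2 \<le> real n * w"
  proof (rule half_growth_bound[of K "\<lambda>n. (a n)\<^sup>2" 0])
    fix n assume "K \<le> n"
    then show "(a (Suc n))\<^sup>2 \<le> (1 + 1 / (2 * real n))\<^sup>2 * (a n)\<^sup>2 + 0"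
      using square_factor_le[of n] K unfolding a_Suc power_mult_distrib
      by (simp add: mult.commute mult_left_mono)
  qed (use K that in auto)
  have "0 < real K * w" using w(2)[of K] a_pos[of K] by (smt (verit) zero_less_power order_refl)
  then have "0 < w" using K by (simp add: zero_less_mult_iff)
  have "(harm n - harm K) / w \<le> (\<Sum>k<n. W k)" if "K \<le> n" for n
    using that
  proof (induction n rule: dec_induct)
    case base
    then show ?case by (simp add: sum_nonneg less_imp_le[OF W_pos])
  next
    case (step n)
    have "1 / (real (Suc n) * w) \<le> W n"
      using w(2)[of "Suc n"] step.hyps a_pos[of "Suc n"] \<open>0 < w\<close> unfolding W_def
      by (intro divide_left_mono mult_pos_pos zero_less_power) simp_all
    then have "inverse (real (Suc n)) / w \<le> W n" by (simp only: divide_inverse inverse_mult_distrib mult_1)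
    then show ?case using step.IH by (simp add: harm_Suc diff_divide_distrib add_divide_distrib)
  qed
  then have "\<forall>\<^sub>F n in sequentially. (harm n - harm K) / w \<le> (\<Sum>k<n. W k)"
    by (auto simp: eventually_sequentially)
  moreover have "filterlim (\<lambda>n. (harm n - harm K) / w) at_top sequentially"
  proof -
    have "filterlim (\<lambda>n. - harm K + harm n :: real) at_top sequentially"
      by (rule filterlim_tendsto_add_at_top[OF tendsto_const harm_at_top])
    then show ?thesis
      using filterlim_at_top_mult_tendsto_pos[OF tendsto_const, of "1 / w" _ sequentially] \<open>0 < w\<close>
      by simp
  qed
  ultimately show ?thesis by (rule filterlim_at_top_mono[rotated])
qed

text \<open>The growth bound makes the second moment \<open>O(n powr (3/2))\<close>; since the
  variance of \<open>\<bar>Y n\<bar>\<close> is nonnegative, the first absolute moment is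
  \<open>O(n powr (3/4))\<close>.\<close>

lemma mean_abs_Y_over_n:
  assumes "\<forall>\<^sub>F n in sequentially. c n \<le> 1 / 2"
  shows "(\<lambda>n. expectation (\<lambda>\<omega>. \<bar>Y n \<omega>\<bar>) / real n) \<longlonglongrightarrow> 0"
proof -
  obtain K where K: "1 \<le> K" "\<And>n. K \<le> n \<Longrightarrow> c n \<le> 1 / 2"
    using eventually_conj[OF assms eventually_ge_at_top[of 1]]
    unfolding eventually_sequentially by (metis dual_order.trans le_refl)
  obtain w where w: "0 \<le> w"
    "\<And>n. K \<le> n \<Longrightarrow> expectation (\<lambda>\<omega>. (Y n \<omega>)\<^sup>2) \<le> real n * (w + 2 * 4 * sqrt (real n))"
  proof (rule half_growth_bound[of K "\<lambda>n. expectation (\<lambda>\<omega>. (Y n \<omega>)\<^sup>2)" 4])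
    fix n assume "K \<le> n"
    then have "(1 + c n / real n)\<^sup>2 * expectation (\<lambda>\<omega>. (Y n \<omega>)\<^sup>2)
        \<le> (1 + 1 / (2 * real n))\<^sup>2 * expectation (\<lambda>\<omega>. (Y n \<omega>)\<^sup>2)"
      using square_factor_le[of n] K by (intro mult_right_mono) auto
    then show "expectation (\<lambda>\<omega>. (Y (Suc n) \<omega>)\<^sup>2)
        \<le> (1 + 1 / (2 * real n))\<^sup>2 * expectation (\<lambda>\<omega>. (Y n \<omega>)\<^sup>2) + 4"
      using second_moment_Suc[of n] by linarith
  qed (use K that in auto)
  have bound: "expectation (\<lambda>\<omega>. \<bar>Y n \<omega>\<bar>) / real n \<le> sqrt (real n * (w + 8 * sqrt (real n))) / real n"
    if "K \<le> n" for n
  proof -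
    have "integrable M (\<lambda>\<omega>. \<bar>Y n \<omega>\<bar>\<^sup>2)"
      using power_mono[OF Y_bound abs_ge_zero, of _ n 2]
      by (intro integrable_bounded[where K="(2 * real n)\<^sup>2"]) auto
    then have "variance (\<lambda>\<omega>. \<bar>Y n \<omega>\<bar>)
        = expectation (\<lambda>\<omega>. \<bar>Y n \<omega>\<bar>\<^sup>2) - (expectation (\<lambda>\<omega>. \<bar>Y n \<omega>\<bar>))\<^sup>2"
      using integrable_Y by (intro variance_eq) auto
    then have "(expectation (\<lambda>\<omega>. \<bar>Y n \<omega>\<bar>))\<^sup>2 \<le> expectation (\<lambda>\<omega>. (Y n \<omega>)\<^sup>2)"
      using variance_positive[of "\<lambda>\<omega>. \<bar>Y n \<omega>\<bar>"] by simp
    also have "\<dots> \<le> real n * (w + 8 * sqrt (real n))" using w(2)[OF that] by simp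
    finally show ?thesis by (intro divide_right_mono real_le_rsqrt) auto
  qed
  have "(\<lambda>n. sqrt (real n * (w + 8 * sqrt (real n))) / real n) \<longlonglongrightarrow> 0"
    by real_asymp
  then show ?thesis
    by (rule tendsto_sandwich[OF _ _ tendsto_const, rotated 2])
      (auto simp: eventually_sequentially intro!: exI[of _ K] bound)
qed

section \<open>Comparison of characteristic functions with Gaussian ones\<close>

text \<open>Integrating out the last step given the past leaves the two-point characteristic
  function with the random mean \<open>h k\<close>. The two-point estimate exchanges it for the
  Gaussian factor with the deterministic mean, at a cost governed by
  \<open>\<bar>Y k\<bar> / k\<close>.\<close>

lemma char_step:
  fixes \<tau> :: real and k :: nat
  defines "s \<equiv> \<tau> / a (Suc k)"
  shows "cmod ((CLINT \<omega>|M. iexp (\<tau> * (Y (Suc k) \<omega> / a (Suc k))))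
      - exp (- (s\<^sup>2 * (1 - (expectation (X (Suc k)))\<^sup>2) / 2)) * (CLINT \<omega>|M. iexp (\<tau> * (Y k \<omega> / a k))))
    \<le> 4 / 3 * \<bar>s\<bar> ^ 3 + s ^ 4 / 8 + s\<^sup>2 * (expectation (\<lambda>\<omega>. \<bar>Y k \<omega>\<bar>) / real k)"
proof -
  let ?m = "expectation (X (Suc k))"
  define \<theta> where "\<theta> \<omega> = iexp (\<tau> * (Y k \<omega> / a k))" for \<omega>
  define u where "u \<omega> = iexp (s * (1 - h k \<omega>))" for \<omega>
  define v where "v \<omega> = iexp (- (s * (1 + h k \<omega>)))" for \<omega>
  define e where "e = exp (- (s\<^sup>2 * (1 - ?m\<^sup>2) / 2))"
  \<comment> \<open>The conditional expectation of \<open>iexp (s * (X (Suc k) - h k))\<close> given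
    the past.\<close>
  define G where "G \<omega> = ((1 + h k \<omega>) / 2) * u \<omega> + ((1 - h k \<omega>) / 2) * v \<omega>" for \<omega>
  have [measurable]: "\<theta> \<in> borel_measurable (F k)" "u \<in> borel_measurable (F k)"
      "v \<in> borel_measurable (F k)"
    unfolding \<theta>_def[abs_def] u_def[abs_def] v_def[abs_def] by measurable
  note [measurable] = this[THEN F_measurable_M]
  have norms: "cmod (\<theta> \<omega>) = 1" "cmod (u \<omega>) = 1" "cmod (v \<omega>) = 1" for \<omega>
    unfolding \<theta>_def u_def v_def by (auto simp: norm_exp_i_times)
  \<comment> \<open>Every function on the two points \<open>1\<close> and \<open>-1\<close> is
    affine. With coefficients depending on the past only, \<open>X (Suc k)\<close> may then be
    replaced by \<open>h k\<close> under the integral.\<close>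
  have step: "iexp (\<tau> * (Y (Suc k) \<omega> / a (Suc k)))
      = \<theta> \<omega> * ((u \<omega> + v \<omega>) / 2) + \<theta> \<omega> * ((u \<omega> - v \<omega>) / 2) * X (Suc k) \<omega>"
    if "\<omega> \<in> space M" for \<omega>
  proof -
    have "\<tau> * (Y (Suc k) \<omega> / a (Suc k)) = \<tau> * (Y k \<omega> / a k) + s * (X (Suc k) \<omega> - h k \<omega>)"
    proof -
      have "\<tau> * ((\<gamma> * y + d) / (z * \<gamma>)) = \<tau> * (y / z) + \<tau> / (z * \<gamma>) * d"
        if "0 < \<gamma>" "0 < z" for \<gamma> y d z :: real
        using that by (simp add: field_simps)
      then show ?thesis unfolding Y_Suc s_def a_Suc using factor_pos a_pos by blast
    qed
    then have "iexp (\<tau> * (Y (Suc k) \<omega> / a (Suc k))) = \<theta> \<omega> * iexp (s * (X (Suc k) \<omega> - h k \<omega>))"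
      unfolding \<theta>_def by (simp only: of_real_add distrib_left exp_add)
    also have "iexp (s * (X (Suc k) \<omega> - h k \<omega>)) = (u \<omega> + v \<omega>) / 2 + ((u \<omega> - v \<omega>) / 2) * X (Suc k) \<omega>"
    proof -
      have "X (Suc k) \<omega> = - 1 \<or> X (Suc k) \<omega> = 1" using X_values[of "Suc k" \<omega>] that by auto
      moreover have "s * (- 1 - h k \<omega>) = - (s * (1 + h k \<omega>))" by (simp add: algebra_simps)
      ultimately show ?thesis unfolding u_def v_def by (auto simp: field_simps)
    qed
    finally show ?thesis by (simp only: distrib_left mult.assoc)
  qed
  have half: "cmod ((u \<omega> + v \<omega>) / 2) \<le> 1" "cmod ((u \<omega> - v \<omega>) / 2) \<le> 1" for \<omega>
    using norm_triangle_ineq[of "u \<omega>" "v \<omega>"] norm_triangle_ineq4[of "u \<omega>" "v \<omega>"] norms[of \<omega>]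
    by (simp_all add: norm_divide)
  have one: "cmod (z * w) \<le> 1" if "cmod z \<le> 1" "cmod w \<le> 1" for z w :: complex
    using mult_mono[OF that] by (simp add: norm_mult)
  have i1: "integrable M (\<lambda>\<omega>. \<theta> \<omega> * ((u \<omega> + v \<omega>) / 2))"
    by (rule integrable_bounded[where K=1], measurable, intro one half)
      (simp_all add: norms)
  have i2: "integrable M (\<lambda>\<omega>. \<theta> \<omega> * ((u \<omega> - v \<omega>) / 2) * X (Suc k) \<omega>)"
    by (rule integrable_bounded[where K=1], measurable, intro one half)
      (simp_all add: norms X_abs)
  have i3: "integrable M (\<lambda>\<omega>. \<theta> \<omega> * ((u \<omega> - v \<omega>) / 2) * h k \<omega>)"
    by (rule integrable_bounded[where K=1], measurable, intro one half)
      (simp_all add: norms h_bound)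
  have i4: "integrable M \<theta>"
    by (rule integrable_bounded[where K=1]) (auto simp: norms)
  have "(CLINT \<omega>|M. iexp (\<tau> * (Y (Suc k) \<omega> / a (Suc k))))
      = (CLINT \<omega>|M. \<theta> \<omega> * ((u \<omega> + v \<omega>) / 2) + \<theta> \<omega> * ((u \<omega> - v \<omega>) / 2) * X (Suc k) \<omega>)"
    by (intro Bochner_Integration.integral_cong step refl)
  also have "\<dots> = (CLINT \<omega>|M. \<theta> \<omega> * ((u \<omega> + v \<omega>) / 2))
      + (CLINT \<omega>|M. \<theta> \<omega> * ((u \<omega> - v \<omega>) / 2) * X (Suc k) \<omega>)"
    by (rule Bochner_Integration.integral_add[OF i1 i2])
  also have "(CLINT \<omega>|M. \<theta> \<omega> * ((u \<omega> - v \<omega>) / 2) * X (Suc k) \<omega>)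
      = (CLINT \<omega>|M. \<theta> \<omega> * ((u \<omega> - v \<omega>) / 2) * h k \<omega>)"
    by (rule step_mean_complex[where K=1], measurable, intro one half) (simp_all add: norms)
  also have "(CLINT \<omega>|M. \<theta> \<omega> * ((u \<omega> + v \<omega>) / 2)) + (CLINT \<omega>|M. \<theta> \<omega> * ((u \<omega> - v \<omega>) / 2) * h k \<omega>)
      = (CLINT \<omega>|M. \<theta> \<omega> * ((u \<omega> + v \<omega>) / 2) + \<theta> \<omega> * ((u \<omega> - v \<omega>) / 2) * h k \<omega>)"
    by (rule Bochner_Integration.integral_add[OF i1 i3, symmetric])
  also have "\<dots> = (CLINT \<omega>|M. \<theta> \<omega> * G \<omega>)"
    unfolding G_def by (intro Bochner_Integration.integral_cong refl) (simp add: field_simps)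
  finally have "(CLINT \<omega>|M. iexp (\<tau> * (Y (Suc k) \<omega> / a (Suc k)))) - e * (CLINT \<omega>|M. \<theta> \<omega>)
      = (CLINT \<omega>|M. \<theta> \<omega> * G \<omega>) - (CLINT \<omega>|M. \<theta> \<omega> * e)" by simp
  also have "\<dots> = (CLINT \<omega>|M. \<theta> \<omega> * (G \<omega> - e))"
  proof -
    have "integrable M (\<lambda>\<omega>. \<theta> \<omega> * ((u \<omega> + v \<omega>) / 2) + \<theta> \<omega> * ((u \<omega> - v \<omega>) / 2) * h k \<omega>)"
      by (rule Bochner_Integration.integrable_add[OF i1 i3])
    then have "integrable M (\<lambda>\<omega>. \<theta> \<omega> * G \<omega>)"
      by (rule Bochner_Integration.integrable_cong[THEN iffD1, rotated 2])
        (auto simp: G_def field_simps)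
    then show ?thesis
      using i4 by (simp add: right_diff_distrib)
  qed
  also have "cmod \<dots> \<le> expectation (\<lambda>\<omega>. (4 / 3 * \<bar>s\<bar> ^ 3 + s ^ 4 / 8) + s\<^sup>2 / real k * \<bar>Y k \<omega>\<bar>)"
  proof (rule order_trans[OF integral_norm_bound integral_mono])
    show "integrable M (\<lambda>\<omega>. (4 / 3 * \<bar>s\<bar> ^ 3 + s ^ 4 / 8) + s\<^sup>2 / real k * \<bar>Y k \<omega>\<bar>)"
      using integrable_Y by simp
    show "cmod (\<theta> \<omega> * (G \<omega> - e)) \<le> (4 / 3 * \<bar>s\<bar> ^ 3 + s ^ 4 / 8) + s\<^sup>2 / real k * \<bar>Y k \<omega>\<bar>"
      if "\<omega> \<in> space M" for \<omega>
    proof -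
      have "cmod (\<theta> \<omega> * (G \<omega> - e)) = cmod (G \<omega> - e)" by (simp add: norm_mult norms)
      also have "\<dots> \<le> 4 / 3 * \<bar>s\<bar> ^ 3 + s ^ 4 / 8 + s\<^sup>2 * \<bar>h k \<omega> - ?m\<bar>"
        unfolding G_def e_def u_def v_def by (rule char_two_point[OF h_bound[OF that] expectation_X_bound])
      also have "\<bar>h k \<omega> - ?m\<bar> \<le> \<bar>Y k \<omega>\<bar> / real k"
        unfolding h_deviation using drift_bound[of k] mult_right_mono[of "\<bar>c k\<bar>" 1 "\<bar>Y k \<omega>\<bar> / real k"]
        by (simp add: abs_mult)
      finally show ?thesis by (simp add: mult_left_mono)
    qed
    have "integrable M (\<lambda>\<omega>. \<theta> \<omega> * ((u \<omega> + v \<omega>) / 2) + \<theta> \<omega> * ((u \<omega> - v \<omega>) / 2) * h k \<omega> - \<theta> \<omega> * e)"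
      using i1 i3 i4 by (intro Bochner_Integration.integrable_add Bochner_Integration.integrable_diff) auto
    then have "integrable M (\<lambda>\<omega>. \<theta> \<omega> * (G \<omega> - e))"
      by (rule Bochner_Integration.integrable_cong[THEN iffD1, rotated 2])
        (auto simp: G_def field_simps)
    then show "integrable M (\<lambda>\<omega>. cmod (\<theta> \<omega> * (G \<omega> - e)))" by (rule integrable_norm)
  qed
  also have "\<dots> = 4 / 3 * \<bar>s\<bar> ^ 3 + s ^ 4 / 8 + s\<^sup>2 * (expectation (\<lambda>\<omega>. \<bar>Y k \<omega>\<bar>) / real k)"
    using integrable_Y[of k] by (simp add: prob_space)
  finally show ?thesis unfolding \<theta>_def e_def .
qed

text \<open>The square of the normalisation \<open>A n\<close> of the theorem.\<close>

definition B :: "nat \<Rightarrow> real" where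
  "B n = (\<Sum>k<n. W k * (1 - (expectation (X (Suc k)))\<^sup>2))"

lemma B_nonneg: "0 \<le> B n"
  unfolding B_def using expectation_X_bound W_pos
  by (intro sum_nonneg mult_nonneg_nonneg) (auto simp: abs_square_le_1 less_imp_le)

text \<open>Induction over the steps: the Gaussian factor \<open>e\<close> of the new step lies in
  \<open>[0, 1]\<close>, so earlier errors are not amplified and the one-step errors simply add
  up.\<close>

lemma char_sum_bound:
  fixes \<tau> :: real
  shows "cmod ((CLINT \<omega>|M. iexp (\<tau> * (Y n \<omega> / a n))) - exp (- (\<tau>\<^sup>2 * B n / 2)))
    \<le> (\<Sum>k<n. 4 / 3 * \<bar>\<tau> / a (Suc k)\<bar> ^ 3 + (\<tau> / a (Suc k)) ^ 4 / 8
        + (\<tau> / a (Suc k))\<^sup>2 * (expectation (\<lambda>\<omega>. \<bar>Y k \<omega>\<bar>) / real k))"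
proof (induction n)
  case 0
  have "Y 0 \<omega> = 0" for \<omega> by (simp add: Y_def S_def expectation_S)
  then show ?case by (simp add: B_def prob_space)
next
  case (Suc n)
  define e where "e = exp (- ((\<tau> / a (Suc n))\<^sup>2 * (1 - (expectation (X (Suc n)))\<^sup>2) / 2))"
  let ?\<phi> = "\<lambda>n. CLINT \<omega>|M. iexp (\<tau> * (Y n \<omega> / a n))"
  let ?E = "exp (- (\<tau>\<^sup>2 * B n / 2))"
  have "0 \<le> 1 - (expectation (X (Suc n)))\<^sup>2"
    using expectation_X_bound[of n] by (simp add: abs_square_le_1)
  then have e: "0 \<le> e" "e \<le> 1" unfolding e_def by simp_all
  have "- (\<tau>\<^sup>2 * B (Suc n) / 2)
      = - ((\<tau> / a (Suc n))\<^sup>2 * (1 - (expectation (X (Suc n)))\<^sup>2) / 2) + - (\<tau>\<^sup>2 * B n / 2)"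
    unfolding B_def W_def sum.lessThan_Suc power_divide by (simp add: distrib_left add_divide_distrib)
  then have E: "exp (- (\<tau>\<^sup>2 * B (Suc n) / 2)) = e * ?E"
    unfolding e_def by (simp only: exp_add)
  have contract: "cmod (z' - of_real (e * d)) \<le> cmod (z - of_real d) + cmod (z' - e * z)"
    for z z' :: complex and d :: real
  proof -
    have "z' - of_real (e * d) = e * (z - of_real d) + (z' - e * z)" by (simp add: algebra_simps)
    also have "cmod \<dots> \<le> cmod (e * (z - of_real d)) + cmod (z' - e * z)" by (rule norm_triangle_ineq)
    also have "cmod (e * (z - of_real d)) \<le> cmod (z - of_real d)"
      unfolding norm_mult norm_of_real using e by (intro mult_left_le_one_le) auto
    finally show ?thesis by simp
  qed
  show ?case
    unfolding E sum.lessThan_Suc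
    by (rule order_trans[OF contract add_mono], rule Suc.IH,
        rule char_step[where k=n and \<tau>=\<tau>, folded e_def])
qed

text \<open>For \<open>\<tau> = t / sqrt (B n)\<close> the error of step \<open>k\<close> is at most
  \<open>L / C n * (W k * r k)\<close> with a null sequence \<open>r\<close>, so the total error is
  \<open>L\<close> times a weighted mean of \<open>r\<close>.\<close>

theorem char_convergence:
  assumes half: "\<forall>\<^sub>F n in sequentially. c n \<le> 1 / 2"
    and \<rho>: "0 < \<rho>" "\<forall>\<^sub>F n in sequentially. \<bar>expectation (X (Suc n))\<bar> \<le> 1 - \<rho>"
  shows "(\<lambda>n. CLINT \<omega>|M. iexp (t * (Y n \<omega> / (a n * sqrt (B n))))) \<longlonglongrightarrow> exp (- (t\<^sup>2) / 2)"
proof -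
  define C where "C n = (\<Sum>k<n. W k)" for n
  have C_top: "filterlim C at_top sequentially"
    using sum_W_at_top[OF half] unfolding C_def[abs_def] .
  obtain K where K: "\<And>n. K \<le> n \<Longrightarrow> \<bar>expectation (X (Suc n))\<bar> \<le> 1 - \<rho>"
    using \<rho>(2) unfolding eventually_sequentially by blast
  \<comment> \<open>Eventually \<open>B n \<ge> \<rho> / 2 * C n\<close>, whence
    \<open>\<tau>\<^sup>2 \<le> L / C n\<close>.\<close>
  define L where "L = 2 * t\<^sup>2 / \<rho>"
  \<comment> \<open>Error of step \<open>k\<close> relative to its squared size
    \<open>s\<^sup>2\<close>: the Taylor terms, through
    \<open>s\<^sup>2 \<le> 3 * L / (k + 1)\<close> from \<open>W_le\<close>, and the deviation of
    the conditional from the plain mean.\<close>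
  define r where "r k = 4 / 3 * sqrt (3 * L / real (Suc k)) + 3 * L / real (Suc k) / 8
    + expectation (\<lambda>\<omega>. \<bar>Y k \<omega>\<bar>) / real k" for k
  have L: "0 \<le> L" using \<rho> by (simp add: L_def)
  \<comment> \<open>From \<open>K\<close> on the step mean \<open>m\<close> satisfies
    \<open>1 - m\<^sup>2 \<ge> 1 - \<bar>m\<bar> \<ge> \<rho>\<close>.\<close>
  have B_ge: "\<rho> * (C n - C K) \<le> B n" if "K \<le> n" for n
    using that
  proof (induction n rule: dec_induct)
    case base then show ?case by (simp add: B_nonneg)
  next
    case (step n)
    let ?m = "expectation (X (Suc n))"
    have "?m\<^sup>2 \<le> \<bar>?m\<bar>"
      using expectation_X_bound[of n] mult_left_le[of "\<bar>?m\<bar>" "\<bar>?m\<bar>"] by (simp add: power2_eq_square)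
    then have "\<rho> \<le> 1 - ?m\<^sup>2" using K[OF step.hyps(1)] by linarith
    then have "\<rho> * W n \<le> W n * (1 - ?m\<^sup>2)" using W_pos[of n] by (simp add: mult.commute)
    then show ?case using step.IH by (simp add: B_def C_def algebra_simps)
  qed
  have "\<forall>\<^sub>F n in sequentially. 2 * C K + 1 \<le> C n"
    using C_top unfolding filterlim_at_top by blast
  moreover have "\<forall>\<^sub>F n in sequentially. K \<le> n" by (rule eventually_ge_at_top)
  ultimately have bound: "\<forall>\<^sub>F n in sequentially.
    cmod ((CLINT \<omega>|M. iexp (t * (Y n \<omega> / (a n * sqrt (B n))))) - exp (- (t\<^sup>2) / 2))
      \<le> L * ((\<Sum>k<n. W k * r k) / (\<Sum>k<n. W k))"
  proof eventually_elim
    case (elim n)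
    have "0 \<le> C K" unfolding C_def by (intro sum_nonneg) (simp add: W_pos less_imp_le)
    then have C: "0 < C n" using elim by linarith
    have "C n \<le> 2 * (C n - C K)" using elim(1) by (simp add: algebra_simps)
    then have "\<rho> / 2 * C n \<le> \<rho> / 2 * (2 * (C n - C K))" using \<rho> by (intro mult_left_mono) auto
    also have "\<dots> = \<rho> * (C n - C K)" by simp
    also have "\<dots> \<le> B n" by (rule B_ge[OF elim(2)])
    finally have BC: "\<rho> / 2 * C n \<le> B n" .
    then have B: "0 < B n" using mult_pos_pos[of "\<rho> / 2" "C n"] \<rho> C by linarith
    define \<tau> where "\<tau> = t / sqrt (B n)"
    have \<tau>2: "\<tau>\<^sup>2 = t\<^sup>2 / B n" using B by (simp add: \<tau>_def power_divide)
    have "\<tau>\<^sup>2 \<le> t\<^sup>2 / (\<rho> / 2 * C n)"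
      unfolding \<tau>2 using BC B C \<rho> by (intro divide_left_mono) auto
    then have \<tau>L: "\<tau>\<^sup>2 \<le> L / C n" by (simp add: L_def mult.commute)
    have err: "4 / 3 * \<bar>\<tau> / a (Suc k)\<bar> ^ 3 + (\<tau> / a (Suc k)) ^ 4 / 8
        + (\<tau> / a (Suc k))\<^sup>2 * (expectation (\<lambda>\<omega>. \<bar>Y k \<omega>\<bar>) / real k) \<le> L / C n * (W k * r k)"
      if "k < n" for k
    proof -
      let ?s = "\<tau> / a (Suc k)"
      have s2: "?s\<^sup>2 = \<tau>\<^sup>2 * W k" by (simp add: W_def power_divide)
      also have "\<dots> \<le> L / C n * W k" using \<tau>L W_pos[of k] by (intro mult_right_mono) auto
      finally have s1: "?s\<^sup>2 \<le> L / C n * W k" .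
      also have "\<dots> \<le> L / C n * (3 / real (Suc k) * C n)"
        using W_le[OF that] L C unfolding C_def[symmetric] by (intro mult_left_mono) auto
      also have "\<dots> = 3 * L / real (Suc k)" using C by simp
      finally have s3: "?s\<^sup>2 \<le> 3 * L / real (Suc k)" .
      then have s4: "\<bar>?s\<bar> \<le> sqrt (3 * L / real (Suc k))" by (intro real_le_rsqrt) (simp only: power2_abs)
      have q: "4 / 3 * \<bar>s\<bar> ^ 3 + s ^ 4 / 8 + s\<^sup>2 * y = s\<^sup>2 * (4 / 3 * \<bar>s\<bar> + s\<^sup>2 / 8 + y)" for s y :: real
      proof -
        have "\<bar>s\<bar> ^ 3 = s\<^sup>2 * \<bar>s\<bar>" "s ^ 4 = s\<^sup>2 * s\<^sup>2"
          by (simp_all add: eval_nat_numeral power2_eq_square)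
        then show ?thesis by (simp only: distrib_left mult_ac times_divide_eq_right)
      qed
      have "4 / 3 * \<bar>?s\<bar> + ?s\<^sup>2 / 8 + expectation (\<lambda>\<omega>. \<bar>Y k \<omega>\<bar>) / real k \<le> r k"
        unfolding r_def
        by (intro add_mono mult_left_mono divide_right_mono order_refl s3 s4) simp_all
      then have "?s\<^sup>2 * (4 / 3 * \<bar>?s\<bar> + ?s\<^sup>2 / 8 + expectation (\<lambda>\<omega>. \<bar>Y k \<omega>\<bar>) / real k)
          \<le> (L / C n * W k) * r k"
        using s1 L C W_pos[of k] by (intro mult_mono) auto
      then show ?thesis unfolding q by (simp only: mult.assoc)
    qed
    have "t * (Y n \<omega> / (a n * sqrt (B n))) = \<tau> * (Y n \<omega> / a n)" for \<omega>
      by (simp add: \<tau>_def)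
    moreover have "- (t\<^sup>2) / 2 = - (\<tau>\<^sup>2 * B n / 2)" using B by (simp add: \<tau>2)
    ultimately have "cmod ((CLINT \<omega>|M. iexp (t * (Y n \<omega> / (a n * sqrt (B n))))) - exp (- (t\<^sup>2) / 2))
        \<le> (\<Sum>k<n. 4 / 3 * \<bar>\<tau> / a (Suc k)\<bar> ^ 3 + (\<tau> / a (Suc k)) ^ 4 / 8
          + (\<tau> / a (Suc k))\<^sup>2 * (expectation (\<lambda>\<omega>. \<bar>Y k \<omega>\<bar>) / real k))"
      using char_sum_bound[of \<tau> n] by presburger
    also have "\<dots> \<le> (\<Sum>k<n. L / C n * (W k * r k))" by (intro sum_mono err) auto
    also have "\<dots> = L * ((\<Sum>k<n. W k * r k) / (\<Sum>k<n. W k))"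
      unfolding sum_distrib_left[symmetric] C_def by simp
    finally show ?case .
  qed
  have "r \<longlonglongrightarrow> 0"
  proof -
    have "(\<lambda>k. 3 * L / real (Suc k)) \<longlonglongrightarrow> 0" by (rule LIMSEQ_Suc[OF lim_const_over_n])
    then have "(\<lambda>k. 4 / 3 * sqrt (3 * L / real (Suc k)) + 3 * L / real (Suc k) / 8)
        \<longlonglongrightarrow> 4 / 3 * sqrt 0 + 0 / 8"
      by (intro tendsto_intros) simp_all
    then have "(\<lambda>k. 4 / 3 * sqrt (3 * L / real (Suc k)) + 3 * L / real (Suc k) / 8) \<longlonglongrightarrow> 0"
      by simp
    from tendsto_add[OF this mean_abs_Y_over_n[OF half]] show ?thesis by (simp add: r_def[abs_def])
  qed
  then have "(\<lambda>n. (\<Sum>k<n. W k * r k) / (\<Sum>k<n. W k)) \<longlonglongrightarrow> 0"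
    using sum_W_at_top[OF half] W_pos by (intro weighted_cesaro) (auto simp: less_imp_le)
  from tendsto_mult_right_zero[OF this, of L]
  have "(\<lambda>n. (CLINT \<omega>|M. iexp (t * (Y n \<omega> / (a n * sqrt (B n))))) - exp (- (t\<^sup>2) / 2)) \<longlonglongrightarrow> 0"
    by (rule Lim_null_comparison[OF bound])
  then show ?thesis by (simp add: LIM_zero_cancel)
qed

theorem central_limit:
  assumes "\<forall>\<^sub>F n in sequentially. c n \<le> 1 / 2"
    and "0 < \<rho>" "\<forall>\<^sub>F n in sequentially. \<bar>expectation (X (Suc n))\<bar> \<le> 1 - \<rho>"
  shows "weak_conv_m (\<lambda>n. distr M borel (\<lambda>\<omega>. Y n \<omega> / (a n * sqrt (B n)))) std_normal_distribution"
proof (rule levy_continuity)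
  show "real_distribution (distr M borel (\<lambda>\<omega>. Y n \<omega> / (a n * sqrt (B n))))" for n
    by (intro real_distribution_distr) measurable
  show "real_distribution std_normal_distribution" by (rule real_dist_normal_dist)
  have "char (distr M borel (\<lambda>\<omega>. Y n \<omega> / (a n * sqrt (B n)))) t
      = (CLINT \<omega>|M. iexp (t * (Y n \<omega> / (a n * sqrt (B n)))))" for n t
    unfolding char_def by (rule integral_distr) measurable
  then show "(\<lambda>n. char (distr M borel (\<lambda>\<omega>. Y n \<omega> / (a n * sqrt (B n)))) t)
      \<longlonglongrightarrow> char std_normal_distribution t" for t
    unfolding char_std_normal_distribution using char_convergence[OF assms, of t] by simp
qed

section \<open>Keeping the step means away from \<open>1\<close> and \<open>-1\<close>\<close>

text \<open>The mean of \<open>S n / n\<close> lies in \<open>[-1, 1]\<close>, so the affine formula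
  is bounded by the moduli of its coefficients.\<close>

lemma mean_bound_of_drift:
  assumes "\<forall>\<^sub>F n in sequentially. \<bar>c n\<bar> + \<bar>b n\<bar> \<le> 1 - \<rho>"
  shows "\<forall>\<^sub>F n in sequentially. \<bar>expectation (X (Suc n))\<bar> \<le> 1 - \<rho>"
  using assms
proof eventually_elim
  case (elim n)
  have "\<bar>expectation (S n) / real n\<bar> \<le> 1"
    using expectation_S_bound[of n] by (cases "n = 0") auto
  then have "\<bar>c n * (expectation (S n) / real n)\<bar> \<le> \<bar>c n\<bar> * 1"
    unfolding abs_mult[of "c n"] by (rule mult_left_mono) simp
  then show ?case using elim unfolding expectation_X_Suc by linarith
qed

text \<open>With negative memory \<open>c \<le> - \<epsilon>\<close> the mean speed is repelled from \<open>1\<close> and \<open>-1\<close>: the map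
  \<open>r \<mapsto> - \<epsilon> r + (1 - \<epsilon>)\<close> has the fixed point \<open>(1 - \<epsilon>) / (1 + \<epsilon>) < 1\<close>.\<close>

lemma mean_bound_of_negative_memory:
  assumes \<epsilon>: "0 < \<epsilon>" and c: "\<forall>\<^sub>F n in sequentially. c n \<le> - \<epsilon>"
  obtains \<rho> where "0 < \<rho>" "\<forall>\<^sub>F n in sequentially. \<bar>expectation (X (Suc n))\<bar> \<le> 1 - \<rho>"
proof -
  obtain K where K: "1 \<le> K" "\<And>n. K \<le> n \<Longrightarrow> c n \<le> - \<epsilon>"
    using eventually_conj[OF c eventually_ge_at_top[of 1]]
    unfolding eventually_sequentially by (metis dual_order.trans le_refl)
  define s where "s n = \<bar>expectation (S n)\<bar>" for n
  define \<mu> where "\<mu> = (1 - \<epsilon>) / (1 + \<epsilon>)"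
  have c1: "-1 \<le> c n" for n using drift_bound[of n] by linarith
  have "\<epsilon> \<le> 1" using K(2)[of K] c1[of K] by simp
  have \<mu>: "0 \<le> \<mu>" "\<mu> < 1" "\<mu> * (1 + \<epsilon>) = 1 - \<epsilon>"
    using \<epsilon> \<open>\<epsilon> \<le> 1\<close> by (auto simp: \<mu>_def field_simps)
  \<comment> \<open>The offset \<open>K\<close> covers the start, where only the trivial bound on
    the mean of \<open>S K\<close> is known.\<close>
  have s_le: "s n \<le> \<mu> * real n + real K" if "K \<le> n" for n
    using that
  proof (induction n rule: dec_induct)
    case base
    then show ?case using expectation_S_bound[of K] \<mu> by (simp add: s_def add_increasing)
  next
    case (step n)
    have n: "1 \<le> n" using K step.hyps by simp
    have cn: "c n \<le> - \<epsilon>" using K step.hyps by simp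
    have "expectation (S (Suc n)) = (1 + c n / real n) * expectation (S n) + b n"
      using expectation_X_Suc[of n] unfolding expectation_S by (simp add: algebra_simps)
    then have "s (Suc n) \<le> (1 + c n / real n) * s n + \<bar>b n\<bar>"
      unfolding s_def using abs_triangle_ineq[of "(1 + c n / real n) * expectation (S n)" "b n"]
        factor_pos[of n] by (simp add: abs_mult)
    also have "\<bar>b n\<bar> \<le> 1 + c n" using drift_bound[of n] cn \<epsilon> by linarith
    also have "(1 + c n / real n) * s n \<le> (1 + c n / real n) * (\<mu> * real n + real K)"
      using factor_pos[of n] by (intro mult_left_mono step.IH) simp
    also have "(1 + c n / real n) * (\<mu> * real n + real K)
        = \<mu> * real n + real K + c n * \<mu> + c n * (real K / real n)"
      using n by (simp add: field_simps)
    also have "c n * (real K / real n) \<le> 0"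
      using cn \<epsilon> by (intro mult_nonpos_nonneg) auto
    finally have "s (Suc n) \<le> \<mu> * real n + real K + c n * \<mu> + (1 + c n)" by simp
    \<comment> \<open>Combined with \<open>\<mu> * (1 + \<epsilon>) = 1 - \<epsilon>\<close>, this
      says that one step raises the bound by at most \<open>\<mu>\<close>.\<close>
    moreover have "(1 + \<mu>) * (c n + \<epsilon>) \<le> 0" using cn \<mu> by (intro mult_nonneg_nonpos) auto
    then have "c n * \<mu> + (1 + c n) \<le> \<mu>" using \<mu>(3) by (simp add: algebra_simps)
    ultimately show ?case by (simp add: algebra_simps)
  qed
  \<comment> \<open>The mean speed is eventually below the midpoint of \<open>\<mu>\<close> and
    \<open>1\<close>; the remaining gap \<open>(1 - \<mu>) / 2\<close> is multiplied by a memory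
    strength of at least \<open>\<epsilon>\<close>.\<close>
  have "(\<lambda>n. \<mu> + real K / real n) \<longlonglongrightarrow> \<mu> + 0"
    by (intro tendsto_intros lim_const_over_n)
  then have "\<forall>\<^sub>F n in sequentially. \<mu> + real K / real n < (1 + \<mu>) / 2"
    using \<mu> by (intro order_tendstoD(2)) auto
  with eventually_ge_at_top[of K]
  have "\<forall>\<^sub>F n in sequentially. \<bar>expectation (X (Suc n))\<bar> \<le> 1 - \<epsilon> * ((1 - \<mu>) / 2)"
  proof eventually_elim
    case (elim n)
    have n: "1 \<le> n" and cn: "c n \<le> - \<epsilon>" using K elim by auto
    have "s n / real n \<le> (\<mu> * real n + real K) / real n"
      by (intro divide_right_mono s_le elim) simp
    also have "\<dots> = \<mu> + real K / real n" using n by (simp add: field_simps)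
    finally have r: "s n / real n \<le> (1 + \<mu>) / 2" using elim by linarith
    have "\<bar>expectation (X (Suc n))\<bar> \<le> \<bar>c n\<bar> * (s n / real n) + \<bar>b n\<bar>"
      unfolding expectation_X_Suc s_def
      using abs_triangle_ineq[of "c n * (expectation (S n) / real n)" "b n"]
      by (simp add: abs_mult)
    also have "\<dots> \<le> \<bar>c n\<bar> * ((1 + \<mu>) / 2) + (1 - \<bar>c n\<bar>)"
      using drift_bound[of n] by (intro add_mono mult_left_mono r) auto
    also have "\<dots> = 1 - \<bar>c n\<bar> * ((1 - \<mu>) / 2)" by (simp add: field_simps)
    also have "\<dots> \<le> 1 - \<epsilon> * ((1 - \<mu>) / 2)"
      using cn \<mu> by (intro diff_left_mono mult_right_mono) auto
    finally show ?case .
  qed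
  then show ?thesis using \<epsilon> \<mu> by (intro that[of "\<epsilon> * ((1 - \<mu>) / 2)"]) auto
qed

end

section \<open>The dynamic elephant random walk as such a walk\<close>

lemma ell_bounds:
  assumes "\<And>n. n \<ge> 1 \<Longrightarrow> g (\<alpha>, n) \<in> {0..1}"
  shows "ereal (ell_sup g \<alpha>) = limsup (\<lambda>n. ereal (g (\<alpha>, n)))"
    and "ereal (ell_inf g \<alpha>) = liminf (\<lambda>n. ereal (g (\<alpha>, n)))"
    and "0 \<le> ell_inf g \<alpha>" "ell_inf g \<alpha> \<le> ell_sup g \<alpha>"
proof -
  have "\<forall>\<^sub>F n in sequentially. 0 \<le> ereal (g (\<alpha>, n))"
    and "\<forall>\<^sub>F n in sequentially. ereal (g (\<alpha>, n)) \<le> 1"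
    using assms by (auto simp: eventually_sequentially intro!: exI[of _ 1])
  then have "0 \<le> liminf (\<lambda>n. ereal (g (\<alpha>, n)))" "limsup (\<lambda>n. ereal (g (\<alpha>, n))) \<le> 1"
    by (auto intro: Liminf_bounded Limsup_bounded)
  moreover have "liminf (\<lambda>n. ereal (g (\<alpha>, n))) \<le> limsup (\<lambda>n. ereal (g (\<alpha>, n)))"
    by (rule Liminf_le_Limsup) simp
  moreover have "ereal (real_of_ereal u) = u \<and> ereal (real_of_ereal l) = l
      \<and> 0 \<le> real_of_ereal l \<and> real_of_ereal l \<le> real_of_ereal u"
    if "0 \<le> l" "u \<le> 1" "l \<le> u" for l u :: ereal
    using that by (cases l; cases u) auto
  ultimately show "ereal (ell_sup g \<alpha>) = limsup (\<lambda>n. ereal (g (\<alpha>, n)))"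
    "ereal (ell_inf g \<alpha>) = liminf (\<lambda>n. ereal (g (\<alpha>, n)))"
    "0 \<le> ell_inf g \<alpha>" "ell_inf g \<alpha> \<le> ell_sup g \<alpha>"
    unfolding ell_sup_def ell_inf_def by blast+
qed

context derw
begin

lemma g_bounds: "1 \<le> n \<Longrightarrow> 0 \<le> g (\<alpha>, n) \<and> g (\<alpha>, n) \<le> 1"
  using g_range alpha_dom[of n] by (auto simp: Pi_iff)

lemma f_orbit_bounds:
  assumes "x \<in> space \<mu>"
  shows "0 \<le> f ((T ^^ n) x) \<and> f ((T ^^ n) x) \<le> 1"
proof -
  have "(T ^^ n) x \<in> space \<mu>"
    using assms measurable_space[OF T_measurable] by (induction n) auto
  then show ?thesis using f_range by (auto simp: Pi_iff)
qed

text \<open>At \<open>n = 0\<close> the summand \<open>c 0 * (S 0 / real 0)\<close> is zero, so the first step is covered by taking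
  \<open>b 0\<close> to be the mean of \<open>X 1\<close>.\<close>

definition memory :: "nat \<Rightarrow> real" where
  "memory n = (if n = 0 then 0 else (2 * p - 1) * g (\<alpha>, n + 1))"

definition drift :: "'x \<Rightarrow> nat \<Rightarrow> real" where
  "drift x n = (if n = 0 then integral\<^sup>L (P x) (X 1)
    else (1 - g (\<alpha>, n + 1)) * (2 * f ((T ^^ (n + 1)) x) - 1))"

text \<open>\<open>X (Suc n)\<close> is twice the indicator of the event that it equals
  \<open>1\<close>, minus one. So the elephant rule for \<open>\<eta> = 1\<close>, tested against
  \<open>Z\<close>, yields the conditional mean.\<close>

lemma step_mean_derw:
  assumes x: "x \<in> space \<mu>"
    and Z: "Z \<in> borel_measurable (natural_filtration (P x) X n)"
    and K: "\<And>\<omega>. \<omega> \<in> space (P x) \<Longrightarrow> \<bar>Z \<omega>\<bar> \<le> K"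
  shows "integral\<^sup>L (P x) (\<lambda>\<omega>. Z \<omega> * X (Suc n) \<omega>)
    = integral\<^sup>L (P x) (\<lambda>\<omega>. Z \<omega> * (memory n * ((\<Sum>i<n. X (Suc i) \<omega>) / real n) + drift x n))"
proof -
  interpret P: prob_space "P x" by (rule prob_space_P[OF x])
  show ?thesis
  proof (cases "n = 0")
    case True
    then obtain z where z: "\<And>\<omega>. \<omega> \<in> space (P x) \<Longrightarrow> Z \<omega> = z"
      using P.natural_filtration_0_constant Z by blast
    have "integral\<^sup>L (P x) (\<lambda>\<omega>. Z \<omega> * X (Suc n) \<omega>) = integral\<^sup>L (P x) (\<lambda>\<omega>. z * X 1 \<omega>)"
      using True by (intro Bochner_Integration.integral_cong) (auto simp: z)
    moreover have "integral\<^sup>L (P x) (\<lambda>\<omega>. Z \<omega> * (memory n * ((\<Sum>i<n. X (Suc i) \<omega>) / real n) + drift x n))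
        = integral\<^sup>L (P x) (\<lambda>\<omega>. z * integral\<^sup>L (P x) (X 1))"
      using True by (intro Bochner_Integration.integral_cong) (auto simp: z memory_def drift_def)
    ultimately show ?thesis by (simp add: P.prob_space)
  next
    case False
    let ?F = "natural_filtration (P x) X n"
    let ?E = "{\<omega> \<in> space (P x). X (n + 1) \<omega> = 1}"
    let ?q = "\<lambda>\<omega>. g (\<alpha>, n + 1) * (1 / (2 * real n) * (\<Sum>k=1..n. 1 + (2 * p - 1) * X k \<omega> * 1))
      + (1 - g (\<alpha>, n + 1)) * dyn_prob T f x (n + 1) 1"
    have subalg: "subalgebra (P x) ?F"
      by (rule subalgebra_natural_filtration[OF X_measurable[OF x]])
    interpret sub: finite_measure_subalgebra "P x" ?F by unfold_locales (rule subalg)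
    have [measurable]: "X (Suc i) \<in> borel_measurable (P x)" for i by (simp add: X_measurable[OF x])
    note [measurable] = measurable_from_subalg[OF subalg Z]
    have E [measurable]: "?E \<in> sets (P x)" by simp
    have K0: "0 \<le> K" using K P.not_empty by force
    have i1: "integrable (P x) (\<lambda>\<omega>. Z \<omega> * indicat_real ?E \<omega>)"
      by (rule P.integrable_const_bound[of _ K]) (auto simp: indicator_def K0 K)
    have i2: "integrable (P x) Z"
      by (rule P.integrable_const_bound[of _ K]) (auto intro: K)
    have i3: "integrable (P x) (\<lambda>\<omega>. Z \<omega> * real_cond_exp (P x) ?F (indicat_real ?E) \<omega>)"
      using i1 Z by (intro sub.real_cond_exp_intg(1)) auto
    have Zq_AE: "AE \<omega> in P x. Z \<omega> * real_cond_exp (P x) ?F (indicat_real ?E) \<omega> = Z \<omega> * ?q \<omega>"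
      using next_step[OF x, of n 1] False by auto
    have "(\<lambda>\<omega>. \<Sum>k=1..n. 1 + (2 * p - 1) * X k \<omega> * 1) \<in> borel_measurable (P x)"
      by (intro borel_measurable_sum borel_measurable_add borel_measurable_times
          borel_measurable_const X_measurable[OF x]) auto
    then have Zq_meas: "(\<lambda>\<omega>. Z \<omega> * ?q \<omega>) \<in> borel_measurable (P x)" by measurable
    have X_eq: "X (Suc n) \<omega> = 2 * indicat_real ?E \<omega> - 1" if "\<omega> \<in> space (P x)" for \<omega>
      using X_values[OF x _ that, of "Suc n"] that by (auto simp: indicator_def)
    have "integral\<^sup>L (P x) (\<lambda>\<omega>. Z \<omega> * X (Suc n) \<omega>)
        = integral\<^sup>L (P x) (\<lambda>\<omega>. 2 * (Z \<omega> * indicat_real ?E \<omega>) - Z \<omega>)"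
      by (intro Bochner_Integration.integral_cong refl) (simp only: X_eq, simp add: algebra_simps)
    also have "\<dots> = 2 * integral\<^sup>L (P x) (\<lambda>\<omega>. Z \<omega> * indicat_real ?E \<omega>) - integral\<^sup>L (P x) Z"
      using i1 i2 by simp
    also have "integral\<^sup>L (P x) (\<lambda>\<omega>. Z \<omega> * indicat_real ?E \<omega>)
        = integral\<^sup>L (P x) (\<lambda>\<omega>. Z \<omega> * real_cond_exp (P x) ?F (indicat_real ?E) \<omega>)"
      using i1 Z by (intro sub.real_cond_exp_intg(2)[symmetric]) auto
    also have "\<dots> = integral\<^sup>L (P x) (\<lambda>\<omega>. Z \<omega> * ?q \<omega>)"
      using Zq_meas Zq_AE by (intro integral_cong_AE) auto
    also have "2 * integral\<^sup>L (P x) (\<lambda>\<omega>. Z \<omega> * ?q \<omega>) - integral\<^sup>L (P x) Z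
        = integral\<^sup>L (P x) (\<lambda>\<omega>. 2 * (Z \<omega> * ?q \<omega>) - Z \<omega>)"
      using i2 integrable_cong_AE_imp[OF i3 Zq_meas Zq_AE] by simp
    also have "\<dots> = integral\<^sup>L (P x)
        (\<lambda>\<omega>. Z \<omega> * (memory n * ((\<Sum>i<n. X (Suc i) \<omega>) / real n) + drift x n))"
    proof (intro Bochner_Integration.integral_cong refl)
      fix \<omega>
      \<comment> \<open>\<open>G\<close> is the memory weight, \<open>N\<close> the time,
        \<open>r\<close> stands for \<open>2 * p - 1\<close>, \<open>s\<close> for the walk and
        \<open>d\<close> for the dynamic probability.\<close>
      have alg: "2 * (G * (1 / (2 * N) * (N + r * s)) + (1 - G) * d) - 1 = r * G * (s / N) + (1 - G) * (2 * d - 1)"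
        if "0 < N" for G N r s d :: real
        using that by (simp add: field_simps)
      have "(\<Sum>k=1..n. 1 + (2 * p - 1) * X k \<omega> * 1) = real n + (2 * p - 1) * (\<Sum>i<n. X (Suc i) \<omega>)"
        by (simp add: sum.distrib sum_distrib_left sum.atLeast1_atMost_eq)
      then have *: "2 * ?q \<omega> - 1 = memory n * ((\<Sum>i<n. X (Suc i) \<omega>) / real n) + drift x n"
        using False alg[of "real n"] by (simp only: memory_def drift_def dyn_prob_def) simp
      then show "2 * (Z \<omega> * ?q \<omega>) - Z \<omega>
          = Z \<omega> * (memory n * ((\<Sum>i<n. X (Suc i) \<omega>) / real n) + drift x n)"
        unfolding *[symmetric] by (simp only: right_diff_distrib mult.left_commute mult_1_right)
    qed
    finally show ?thesis .
  qed
qed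

lemma memory_drift_le:
  assumes "x \<in> space \<mu>" "1 \<le> n"
  shows "\<bar>memory n\<bar> = \<bar>2 * p - 1\<bar> * g (\<alpha>, n + 1)"
    and "\<bar>drift x n\<bar> = (1 - g (\<alpha>, n + 1)) * \<bar>2 * f ((T ^^ (n + 1)) x) - 1\<bar>"
    and "\<bar>drift x n\<bar> \<le> 1 - g (\<alpha>, n + 1)"
proof -
  show "\<bar>memory n\<bar> = \<bar>2 * p - 1\<bar> * g (\<alpha>, n + 1)"
    "\<bar>drift x n\<bar> = (1 - g (\<alpha>, n + 1)) * \<bar>2 * f ((T ^^ (n + 1)) x) - 1\<bar>"
    using assms g_bounds[of "n + 1"] by (simp_all add: memory_def drift_def abs_mult)
  moreover have "\<bar>2 * f ((T ^^ (n + 1)) x) - 1\<bar> \<le> 1"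
    using f_orbit_bounds[OF assms(1), of "n + 1"] by linarith
  ultimately show "\<bar>drift x n\<bar> \<le> 1 - g (\<alpha>, n + 1)"
    using g_bounds[of "n + 1"] by (simp add: mult_left_le)
qed

lemma memory_bounds: "\<bar>memory n\<bar> \<le> g (\<alpha>, n + 1)" "n = 0 \<or> \<bar>memory n\<bar> \<le> \<bar>2 * p - 1\<bar>"
proof -
  have "\<bar>2 * p - 1\<bar> \<le> 1" using p_range by auto
  then show "\<bar>memory n\<bar> \<le> g (\<alpha>, n + 1)" "n = 0 \<or> \<bar>memory n\<bar> \<le> \<bar>2 * p - 1\<bar>"
    using g_bounds[of "n + 1"]
    by (auto simp: memory_def abs_mult mult_left_le mult_left_le_one_le)
qed

lemma linear_step_walk_derw:
  assumes x: "x \<in> space \<mu>"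
  shows "linear_step_walk (P x) X memory (drift x)"
proof -
  interpret P: prob_space "P x" by (rule prob_space_P[OF x])
  show ?thesis
  proof unfold_locales
    fix n
    show "\<bar>memory n\<bar> + \<bar>drift x n\<bar> \<le> 1"
    proof (cases "n = 0")
      case True
      have "\<bar>integral\<^sup>L (P x) (X 1)\<bar> \<le> integral\<^sup>L (P x) (\<lambda>\<omega>. \<bar>X 1 \<omega>\<bar>)"
        using integral_norm_bound[of "P x" "X 1"] by simp
      also have "\<dots> = integral\<^sup>L (P x) (\<lambda>\<omega>. 1)"
        using X_values[OF x, of 1] by (intro Bochner_Integration.integral_cong refl) force
      finally show ?thesis using True by (simp add: memory_def drift_def P.prob_space)
    next
      case False
      then show ?thesis using memory_drift_le(3)[OF x, of n] memory_bounds(1)[of n] by simp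
    qed
    show "0 < 1 + memory n / real n"
    proof -
      \<comment> \<open>For \<open>n \<ge> 2\<close> the quotient has modulus at most
        \<open>1 / 2\<close>. At \<open>n = 1\<close> the factor
        \<open>1 + (2 * p - 1) * g (\<alpha>, 2)\<close> vanishes only in the excluded case
        \<open>g (\<alpha>, 2) = 1\<close>, \<open>p = 0\<close>.\<close>
      consider "n = 0" | "n = 1" | "2 \<le> n" by linarith
      then show ?thesis
      proof cases
        case 2
        have g2: "0 \<le> g (\<alpha>, 2)" "g (\<alpha>, 2) \<le> 1" using g_bounds[of 2] by auto
        have "0 \<le> 2 * p * g (\<alpha>, 2)" using p_range g2 by auto
        moreover have "g (\<alpha>, 2) < 1 \<or> 0 < 2 * p * g (\<alpha>, 2)"
          using non_degenerate p_range g2 by (cases "g (\<alpha>, 2) = 1") auto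
        ultimately have "0 < 1 + (2 * p - 1) * g (\<alpha>, 2)"
          using g2 by (auto simp: algebra_simps)
        then show ?thesis using 2 by (simp add: memory_def numeral_2_eq_2)
      next
        case 3
        have "\<bar>memory n / real n\<bar> \<le> 1 / 2"
          using memory_bounds(1)[of n] g_bounds[of "n + 1"] 3 by (simp add: abs_divide divide_le_eq)
        then show ?thesis by linarith
      qed (simp add: memory_def)
    qed
  qed (fact X_measurable[OF x] X_values[OF x] step_mean_derw[OF x])+
qed

section \<open>Eventual bounds on memory and drift from the hypotheses\<close>

text \<open>For \<open>p \<le> 3 / 4\<close> the coefficient \<open>2 * p - 1\<close> is at most
  \<open>1 / 2\<close> already; otherwise \<open>g\<close> is eventually below
  \<open>1 / (4 * p - 2)\<close>, which is \<open>1 / 2\<close> divided by that coefficient.\<close>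

lemma eventually_memory_le_half:
  assumes "p \<le> 3 / 4 \<or> ell_sup g \<alpha> < 1 / (4 * p - 2)"
  shows "\<forall>\<^sub>F n in sequentially. memory n \<le> 1 / 2"
proof (cases "p \<le> 3 / 4")
  case True
  have "memory n \<le> 1 / 2" for n
  proof (cases "p \<le> 1 / 2")
    case True
    then show ?thesis using g_bounds[of "n + 1"] mult_nonpos_nonneg[of "2 * p - 1" "g (\<alpha>, n + 1)"]
      by (auto simp: memory_def)
  next
    case False
    then show ?thesis using memory_bounds(2)[of n] True by (auto simp: memory_def)
  qed
  then show ?thesis by simp
next
  case False
  then have "ereal (ell_sup g \<alpha>) < ereal (1 / (4 * p - 2))" using assms by simp
  then have "limsup (\<lambda>n. ereal (g (\<alpha>, n))) < ereal (1 / (4 * p - 2))"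
    using g_bounds by (subst ell_bounds(1)[symmetric]) auto
  then have "\<forall>\<^sub>F n in sequentially. g (\<alpha>, n) < 1 / (4 * p - 2)"
    by (auto dest: Limsup_lessD)
  then have "\<forall>\<^sub>F n in sequentially. g (\<alpha>, n + 1) < 1 / (4 * p - 2)"
    unfolding Suc_eq_plus1[symmetric] by (rule iffD2[OF eventually_sequentially_Suc])
  then show ?thesis
  proof eventually_elim
    case (elim n)
    then have "(2 * p - 1) * g (\<alpha>, n + 1) \<le> (2 * p - 1) * (1 / (4 * p - 2))"
      using False by (intro mult_left_mono) auto
    also have "\<dots> = 1 / 2" using False by (simp add: field_simps)
    finally show ?case by (simp add: memory_def)
  qed
qed

text \<open>The memory takes at most \<open>g\<close> of the unit budget and the drift at most
  \<open>(1 - g) * (1 - \<delta>)\<close>, because \<open>f\<close> stays away from \<open>0\<close>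
  and \<open>1\<close> along the orbit; \<open>g < \<gamma> < 1\<close> leaves the deficit
  \<open>(1 - \<gamma>) * \<delta>\<close>.\<close>

lemma eventually_drift_bound_of_oscillation:
  assumes x: "x \<in> space \<mu>"
    and sup: "ell_sup g \<alpha> < 1"
    and f_lower: "liminf (\<lambda>n. ereal (f ((T ^^ n) x))) > 0"
    and f_upper: "limsup (\<lambda>n. ereal (f ((T ^^ n) x))) < 1"
  obtains \<rho> where "0 < \<rho>" "\<forall>\<^sub>F n in sequentially. \<bar>memory n\<bar> + \<bar>drift x n\<bar> \<le> 1 - \<rho>"
proof -
  obtain l where l: "0 < l" "ereal l < liminf (\<lambda>n. ereal (f ((T ^^ n) x)))"
    using ereal_dense2[OF f_lower] by (auto simp: zero_ereal_def)
  obtain u where u: "u < 1" "limsup (\<lambda>n. ereal (f ((T ^^ n) x))) < ereal u"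
    using ereal_dense2[OF f_upper] by (auto simp: one_ereal_def)
  obtain \<gamma> where \<gamma>: "ell_sup g \<alpha> < \<gamma>" "\<gamma> < 1" using dense[OF sup] by blast
  then have "limsup (\<lambda>n. ereal (g (\<alpha>, n))) < ereal \<gamma>"
    using g_bounds by (subst ell_bounds(1)[symmetric]) auto
  then have ev_g: "\<forall>\<^sub>F n in sequentially. g (\<alpha>, n) < \<gamma>" by (auto dest: Limsup_lessD)
  have ev_f: "\<forall>\<^sub>F n in sequentially. l < f ((T ^^ n) x)" "\<forall>\<^sub>F n in sequentially. f ((T ^^ n) x) < u"
    using less_LiminfD[OF l(2)] Limsup_lessD[OF u(2)] by auto
  \<comment> \<open>Chosen so that \<open>l < f < u\<close> implies
    \<open>\<bar>2 * f - 1\<bar> \<le> 1 - \<delta>\<close>.\<close>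
  define \<delta> where "\<delta> = 2 * min l (1 - u)"
  have \<delta>: "0 < \<delta>" using l u by (simp add: \<delta>_def)
  have "\<forall>\<^sub>F n in sequentially. g (\<alpha>, n) < \<gamma> \<and> l < f ((T ^^ n) x) \<and> f ((T ^^ n) x) < u"
    using ev_g ev_f by eventually_elim simp
  then have "\<forall>\<^sub>F n in sequentially. g (\<alpha>, Suc n) < \<gamma> \<and> l < f ((T ^^ Suc n) x) \<and> f ((T ^^ Suc n) x) < u"
    by (rule iffD2[OF eventually_sequentially_Suc])
  with eventually_ge_at_top[of 1]
  have "\<forall>\<^sub>F n in sequentially. \<bar>memory n\<bar> + \<bar>drift x n\<bar> \<le> 1 - (1 - \<gamma>) * \<delta>"
  proof eventually_elim
    case (elim n)
    have "\<bar>2 * f ((T ^^ (n + 1)) x) - 1\<bar> \<le> 1 - \<delta>"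
      using elim unfolding \<delta>_def min_def abs_le_iff by auto
    then have "\<bar>drift x n\<bar> \<le> (1 - g (\<alpha>, n + 1)) * (1 - \<delta>)"
      unfolding memory_drift_le(2)[OF x elim(1)] using g_bounds[of "n + 1"]
      by (intro mult_left_mono) auto
    then have "\<bar>memory n\<bar> + \<bar>drift x n\<bar> \<le> 1 - (1 - g (\<alpha>, n + 1)) * \<delta>"
      using memory_bounds(1)[of n] by (simp add: algebra_simps)
    also have "\<dots> \<le> 1 - (1 - \<gamma>) * \<delta>"
      using elim \<delta> by (intro diff_left_mono mult_right_mono) auto
    finally show ?case .
  qed
  then show ?thesis using \<gamma> \<delta> by (intro that[of "(1 - \<gamma>) * \<delta>"]) auto
qed

lemma eventually_memory_ge:
  assumes "ell_inf g \<alpha> \<noteq> 0"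
  obtains \<epsilon> where "0 < \<epsilon>" "\<forall>\<^sub>F n in sequentially. \<epsilon> \<le> g (\<alpha>, n + 1)"
proof -
  have "0 \<le> ell_inf g \<alpha>" using g_bounds by (intro ell_bounds(3)) auto
  then have pos: "0 < ell_inf g \<alpha>" using assms by simp
  then have "ereal (ell_inf g \<alpha> / 2) < liminf (\<lambda>n. ereal (g (\<alpha>, n)))"
    using g_bounds by (subst ell_bounds(2)[symmetric]) auto
  then have "\<forall>\<^sub>F n in sequentially. ell_inf g \<alpha> / 2 < g (\<alpha>, n)" by (auto dest: less_LiminfD)
  then have "\<forall>\<^sub>F n in sequentially. ell_inf g \<alpha> / 2 < g (\<alpha>, n + 1)"
    unfolding Suc_eq_plus1[symmetric] by (rule iffD2[OF eventually_sequentially_Suc])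
  then have "\<forall>\<^sub>F n in sequentially. ell_inf g \<alpha> / 2 \<le> g (\<alpha>, n + 1)"
    by eventually_elim simp
  then show ?thesis using pos by (intro that[of "ell_inf g \<alpha> / 2"]) auto
qed

end

section \<open>The central limit theorem for the dynamic elephant random walk\<close>

theorem corollary4:
  fixes \<mu> :: "'x measure" and T :: "'x \<Rightarrow> 'x" and f :: "'x \<Rightarrow> real"
    and p q :: real
    and R :: "(real \<times> nat) set" and g :: "real \<times> nat \<Rightarrow> real" and \<alpha> :: real
    and P :: "'x \<Rightarrow> 'w measure" and X :: "nat \<Rightarrow> 'w \<Rightarrow> real"
    and x :: 'x
  assumes "derw \<mu> T f p q R g \<alpha> P X"
    and "p \<le> 3 / 4 \<or> ell_sup g \<alpha> < 1 / (4 * p - 2)"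
    and "x \<in> space \<mu>"
    and "p * ell_sup g \<alpha> < 1"
    and D1: "p = 1 \<Longrightarrow>
           liminf (\<lambda>n. ereal (f ((T ^^ n) x))) > 0
         \<and> limsup (\<lambda>n. ereal (f ((T ^^ n) x))) < ereal ((1 - ell_sup g \<alpha>) / (1 - ell_inf g \<alpha>))"
    and D2: "ell_inf g \<alpha> = 0 \<Longrightarrow>
           liminf (\<lambda>n. ereal (f ((T ^^ n) x))) > 0
         \<and> limsup (\<lambda>n. ereal (f ((T ^^ n) x))) < ereal (1 - p * ell_sup g \<alpha>)
         \<and> ell_sup g \<alpha> < 1"
  shows "weak_conv_m
           (\<lambda>n. distr (P x) borel
              (\<lambda>\<omega>. (derw_S X n \<omega> - integral\<^sup>L (P x) (derw_S X n))
                    / (derw_a p g \<alpha> n * derw_A (P x) X p g \<alpha> n)))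
           std_normal_distribution"
proof -
  interpret D: derw \<mu> T f p q R g \<alpha> P X by fact
  note x = \<open>x \<in> space \<mu>\<close>
  interpret L: linear_step_walk "P x" X D.memory "D.drift x"
    by (rule D.linear_step_walk_derw[OF x])
  have g01: "\<And>n. n \<ge> 1 \<Longrightarrow> g (\<alpha>, n) \<in> {0..1}" using D.g_bounds by simp
  note ell = ell_bounds(3,4)[of g \<alpha>, OF g01]
  have S: "derw_S X n = L.S n" for n
    by (simp add: derw_S_def[abs_def] L.S_def[abs_def] sum.atLeast1_atMost_eq)
  have a: "derw_a p g \<alpha> n = L.a n" for n
    unfolding derw_a_def L.a_def by (intro prod.cong) (auto simp: D.memory_def)
  have A: "derw_A (P x) X p g \<alpha> n = sqrt (L.B n)" for n
    unfolding derw_A_def L.B_def L.W_def a by (simp add: sum.atLeast1_atMost_eq)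
  \<comment> \<open>Three regimes keep the means away from \<open>1\<close> and \<open>-1\<close>:
    the orbit conditions if \<open>p = 1\<close> or \<open>ell_inf g \<alpha> = 0\<close>, repulsion
    by negative memory if \<open>p = 0\<close>, and otherwise the slack in
    \<open>\<bar>2 * p - 1\<bar> < 1\<close>.\<close>
  obtain \<rho> where "0 < \<rho>"
    "\<forall>\<^sub>F n in sequentially. \<bar>integral\<^sup>L (P x) (X (Suc n))\<bar> \<le> 1 - \<rho>"
  proof (cases "p = 1 \<or> ell_inf g \<alpha> = 0")
    case True
    \<comment> \<open>For \<open>p = 1\<close> this is the hypothesis on
      \<open>p * ell_sup g \<alpha>\<close>; for vanishing \<open>ell_inf g \<alpha>\<close> it is
      part of \<open>D2\<close>.\<close>
    have sup: "ell_sup g \<alpha> < 1" using True D2 \<open>p * ell_sup g \<alpha> < 1\<close> by auto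
    \<comment> \<open>The thresholds in \<open>D1\<close> and \<open>D2\<close> are both at most
      \<open>1\<close>, so either condition puts the limsup below \<open>1\<close>.\<close>
    have "(1 - ell_sup g \<alpha>) / (1 - ell_inf g \<alpha>) \<le> 1" using ell sup by (simp add: divide_le_eq)
    then have "ereal ((1 - ell_sup g \<alpha>) / (1 - ell_inf g \<alpha>)) \<le> 1" by simp
    moreover have "ereal (1 - p * ell_sup g \<alpha>) \<le> 1" using ell D.p_range by simp
    ultimately have f_upper: "limsup (\<lambda>n. ereal (f ((T ^^ n) x))) < 1"
      using True D1 D2 less_le_trans by blast
    have f_lower: "liminf (\<lambda>n. ereal (f ((T ^^ n) x))) > 0" using True D1 D2 by blast
    obtain \<rho> where "0 < \<rho>" "\<forall>\<^sub>F n in sequentially. \<bar>D.memory n\<bar> + \<bar>D.drift x n\<bar> \<le> 1 - \<rho>"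
      by (rule D.eventually_drift_bound_of_oscillation[OF x sup f_lower f_upper])
    from that[OF this(1) L.mean_bound_of_drift[OF this(2)]] show ?thesis .
  next
    case False
    then obtain \<epsilon> where \<epsilon>: "0 < \<epsilon>" "\<forall>\<^sub>F n in sequentially. \<epsilon> \<le> g (\<alpha>, n + 1)"
      using D.eventually_memory_ge by blast
    have ev: "\<forall>\<^sub>F n in sequentially. 1 \<le> n \<and> \<epsilon> \<le> g (\<alpha>, n + 1)"
      using \<epsilon>(2) eventually_ge_at_top[of 1] by eventually_elim simp
    show ?thesis
    proof (cases "p = 0")
      case True
      have "\<forall>\<^sub>F n in sequentially. D.memory n \<le> - \<epsilon>"
        using ev unfolding D.memory_def by eventually_elim (use True in simp)
      then show ?thesis using L.mean_bound_of_negative_memory[OF \<epsilon>(1)] that by blast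
    next
      case p: False
      \<comment> \<open>Memory and drift together are at most
        \<open>\<bar>2 * p - 1\<bar> * g + (1 - g) = 1 - \<kappa> * g\<close>.\<close>
      define \<kappa> where "\<kappa> = 1 - \<bar>2 * p - 1\<bar>"
      have \<kappa>: "0 < \<kappa>" using p False D.p_range by (auto simp: \<kappa>_def abs_if)
      have "\<forall>\<^sub>F n in sequentially. \<bar>D.memory n\<bar> + \<bar>D.drift x n\<bar> \<le> 1 - \<kappa> * \<epsilon>"
        using ev
      proof eventually_elim
        case (elim n)
        then have "\<bar>D.memory n\<bar> + \<bar>D.drift x n\<bar> \<le> 1 - \<kappa> * g (\<alpha>, n + 1)"
          using D.memory_drift_le(1,3)[OF x, of n] by (simp add: \<kappa>_def algebra_simps)
        also have "\<dots> \<le> 1 - \<kappa> * \<epsilon>" using elim \<kappa> by simp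
        finally show ?case .
      qed
      from that[OF mult_pos_pos[OF \<kappa> \<epsilon>(1)] L.mean_bound_of_drift[OF this]] show ?thesis .
    qed
  qed
  from L.central_limit[OF D.eventually_memory_le_half[OF assms(2)] this]
  show ?thesis unfolding S a A L.Y_def .
qed

end
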